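(* Let $(G_c^*,V^* )$, with $V^*(t)=\mathrm{diag}(v^*(t))$, be a local optimal solution of the relaxed problem described in the context, and for $j\in\{1,\dots,p\}$ and $t\in[0,T]$ let $$q_j(t)= b_j^\top e^{A^\top(T-t)}\,\frac{\partial K(G_c^*(T))}{\partial G_c^*(T)}\,e^{A(T-t)}b_j .$$ Assume that $q_j$ is not constant on $[0,T]$ for all $j\in\{1,\dots,p\}$ and that $q_i-q_j$ is not constant on $[0,T]$ for all $i,j\in\{1,\dots,p\}$ with $i\neq j$. Denote the set of all solutions (maximizers) of the main problem and of the relaxed problem by $\mathcal{V}_0^*$ and $\mathcal{V}_1^*$, respectively. If the set $\mathcal{V}_1^*$ is not empty, then $\mathcal{V}_0^*=\mathcal{V}_1^*$.
   Context: Fix positive integers $n,p$, a time $T>0$, matrices $A\in\mathbb{R}^{n\times n}$ and $B\in\mathbb{R}^{n\times p}$ with columns $b_1,\dots,b_p\in\mathbb{R}^n$, constants $\alpha_1,\dots,\alpha_p>0$ and $\beta>0$, and a continuously differentiable real-valued function $K$ of an $n\times n$ real matrix. Here $\frac{\partial K(G)}{\partial G}\in\mathbb{R}^{n\times n}$ is the matrix of partial derivatives of $K$ with respect to the entries of $G$. For a measurable $v:[0,T]\to[0,1]^p$ put $V(t)=\mathrm{diag}(v(t))\in\mathbb{R}^{p\times p}$ and let $G_c:[0,T]\to\mathbb{R}^{n\times n}$ be the solution of the controllability Lyapunov differential equation $$\dot G_c(t)=AG_c(t)+G_c(t)A^\top+BV(t)B^\top,\qquad G_c(0)=0 .$$ Set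 $J(v)=K(G_c(T))$. Norms: for $w\in\mathbb{R}^p$, $\|w\|_{l^0}$ is the number of nonzero components of $w$ and $\|w\|_{l^1}=\sum_j|w_j|$; for measurable $f:[0,T]\to\mathbb{R}$, $\|f\|_{L^0}$ is the Lebesgue measure of $\{t\in[0,T]:f(t)\neq0\}$ and $\|f\|_{L^1}=\int_0^T|f(t)|\,dt$. Feasible sets of measurable functions $v=(v_1,\dots,v_p)$ on $[0,T]$: $$\mathcal{V}_0=\{v: v(t)\in\{0,1\}^p\ \forall t\in[0,T],\ \|v_j\|_{L^0}\le\alpha_j\ \forall j,\ \|v(t)\|_{l^0}\le\beta\ \forall t\in[0,T]\},$$ $$\mathcal{V}_1=\{v: v(t)\in[0,1]^p\ \forall t\in[0,T],\ \|v_j\|_{L^1}\le\alpha_j\ \forall j,\ \|v(t)\|_{l^1}\le\beta\ \forall t\in[0,T]\}.$$ The main problem is to maximize $J$ over $\mathcal{V}_0$, and the relaxed problem is to maximize $J$ over $\mathcal{V}_1$. Local optimality: for $v\in\mathcal{V}_1$ let $y_j(t)=\int_0^t v_j(s)\,ds$. A function $v^*\in\mathcal{V}_1$, with corresponding $G_c^*,y^*$ (equivalently, the pair $(G_c^*,V^* )$), is a local optimal solution of the relaxed problem if there is $\varepsilon>0$ such that $J(v)\le J(v^* )$ for every $v\in\mathcal{V}_1$ whose corresponding $(G_c,y)$ satisfies $\|G_c(t)-G_c^*(t)\|\le\varepsilon$ and $\|y(t)-y^*(t)\|\le\varepsilon$ for all $t\in[0,T]$ (Frobenius and Euclidean nor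ms).
   Formalization: Maximizers are identified when equal almost everywhere on [0,T]; β is assumed to be an integer or at least p; and the non-constancy of q_j and q_i−q_j is assumed at every local optimal solution of the relaxed problem, since the claim fails otherwise. *)

theory Defs
  imports "HOL-Analysis.Analysis"
begin

text \<open>The type \<open>real ^ 'n ^ 'n\<close> has no algebra structure for the matrix product, so the
  library exponential does not apply; the power series is written out.\<close>

primrec mat_power :: "real ^ 'n ^ 'n \<Rightarrow> nat \<Rightarrow> real ^ 'n ^ 'n" where
  "mat_power M 0 = mat 1"
| "mat_power M (Suc k) = M ** mat_power M k"

definition mat_exp :: "real ^ 'n ^ 'n \<Rightarrow> real ^ 'n ^ 'n" where
  "mat_exp M = (\<Sum>k. (1 / fact k) *\<^sub>R mat_power M k)"

definition diag_mat :: "real ^ 'p \<Rightarrow> real ^ 'p ^ 'p" where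
  "diag_mat w = (\<chi> i j. if i = j then w $ i else 0)"

text \<open>\<open>axis i (axis j 1)\<close> is the matrix unit with entry 1 in row \<open>i\<close> and column \<open>j\<close>.\<close>

definition mat_grad :: "(real ^ 'n ^ 'n \<Rightarrow> real) \<Rightarrow> real ^ 'n ^ 'n \<Rightarrow> real ^ 'n ^ 'n" where
  "mat_grad K G = (\<chi> i j. deriv (\<lambda>s. K (G + s *\<^sub>R axis i (axis j 1))) 0)"

definition cont_diff :: "(real ^ 'n ^ 'n \<Rightarrow> real) \<Rightarrow> bool" where
  "cont_diff K \<longleftrightarrow> (\<forall>G. K differentiable (at G)) \<and> continuous_on UNIV (mat_grad K)"

text \<open>The input \<open>v\<close> is only measurable, so the Lyapunov equation is understood in the sense of
  Caratheodory: \<open>G\<close> is the Lebesgue integral of the right-hand side, i.e. it is absolutely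
  continuous, starts at 0, and satisfies the equation almost everywhere.\<close>

definition lyap_rhs ::
    "real ^ 'n ^ 'n \<Rightarrow> real ^ 'p ^ 'n \<Rightarrow> real ^ 'p \<Rightarrow> real ^ 'n ^ 'n \<Rightarrow> real ^ 'n ^ 'n" where
  "lyap_rhs A B w G = A ** G + G ** transpose A + B ** diag_mat w ** transpose B"

definition lyap_solution ::
    "real ^ 'n ^ 'n \<Rightarrow> real ^ 'p ^ 'n \<Rightarrow> real \<Rightarrow> (real \<Rightarrow> real ^ 'p) \<Rightarrow> (real \<Rightarrow> real ^ 'n ^ 'n) \<Rightarrow> bool"
  where
  "lyap_solution A B T v G \<longleftrightarrow>
     integrable (lebesgue_on {0..T}) (\<lambda>s. lyap_rhs A B (v s) (G s)) \<and>
     (\<forall>t\<in>{0..T}. G t = (LINT s|lebesgue_on {0..t}. lyap_rhs A B (v s) (G s)))"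

text \<open>For bounded measurable \<open>v\<close> a solution exists and is unique on \<open>{0..T}\<close>; the choice operator
  leaves only its values outside \<open>{0..T}\<close> undetermined, and these are never used.\<close>

definition gramian ::
    "real ^ 'n ^ 'n \<Rightarrow> real ^ 'p ^ 'n \<Rightarrow> real \<Rightarrow> (real \<Rightarrow> real ^ 'p) \<Rightarrow> real \<Rightarrow> real ^ 'n ^ 'n" where
  "gramian A B T v = (SOME G. lyap_solution A B T v G)"

definition objective ::
    "real ^ 'n ^ 'n \<Rightarrow> real ^ 'p ^ 'n \<Rightarrow> real \<Rightarrow> (real ^ 'n ^ 'n \<Rightarrow> real) \<Rightarrow> (real \<Rightarrow> real ^ 'p) \<Rightarrow> real"
  where
  "objective A B T K v = K (gramian A B T v T)"

definition l0_norm :: "real ^ 'p \<Rightarrow> nat" where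
  "l0_norm w = card {j. w $ j \<noteq> 0}"

definition l1_norm :: "real ^ 'p \<Rightarrow> real" where
  "l1_norm w = (\<Sum>j\<in>UNIV. \<bar>w $ j\<bar>)"

definition L0_norm :: "real \<Rightarrow> (real \<Rightarrow> real) \<Rightarrow> real" where
  "L0_norm T f = measure lebesgue {t \<in> {0..T}. f t \<noteq> 0}"

definition L1_norm :: "real \<Rightarrow> (real \<Rightarrow> real) \<Rightarrow> real" where
  "L1_norm T f = (LINT t|lebesgue_on {0..T}. \<bar>f t\<bar>)"

definition feasible0 :: "real \<Rightarrow> real ^ 'p \<Rightarrow> real \<Rightarrow> (real \<Rightarrow> real ^ 'p) set" where
  "feasible0 T \<alpha> \<beta> = {v. v \<in> borel_measurable (lebesgue_on {0..T}) \<and>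
     (\<forall>t\<in>{0..T}. \<forall>j. v t $ j \<in> {0, 1}) \<and>
     (\<forall>j. L0_norm T (\<lambda>t. v t $ j) \<le> \<alpha> $ j) \<and>
     (\<forall>t\<in>{0..T}. real (l0_norm (v t)) \<le> \<beta>)}"

definition feasible1 :: "real \<Rightarrow> real ^ 'p \<Rightarrow> real \<Rightarrow> (real \<Rightarrow> real ^ 'p) set" where
  "feasible1 T \<alpha> \<beta> = {v. v \<in> borel_measurable (lebesgue_on {0..T}) \<and>
     (\<forall>t\<in>{0..T}. \<forall>j. v t $ j \<in> {0..1}) \<and>
     (\<forall>j. L1_norm T (\<lambda>t. v t $ j) \<le> \<alpha> $ j) \<and>
     (\<forall>t\<in>{0..T}. l1_norm (v t) \<le> \<beta>)}"

definition maximizers :: "('a \<Rightarrow> real) \<Rightarrow> 'a set \<Rightarrow> 'a set" where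
  "maximizers J V = {v. is_arg_max J (\<lambda>v. v \<in> V) v}"

definition cumulative :: "(real \<Rightarrow> real ^ 'p) \<Rightarrow> real \<Rightarrow> real ^ 'p" where
  "cumulative v t = (\<chi> j. LINT s|lebesgue_on {0..t}. v s $ j)"

text \<open>The library norm on \<open>real ^ 'n ^ 'n\<close> is the Frobenius norm.\<close>

definition local_optimal ::
    "real ^ 'n ^ 'n \<Rightarrow> real ^ 'p ^ 'n \<Rightarrow> real \<Rightarrow> (real ^ 'n ^ 'n \<Rightarrow> real) \<Rightarrow>
     real ^ 'p \<Rightarrow> real \<Rightarrow> (real \<Rightarrow> real ^ 'p) \<Rightarrow> bool" where
  "local_optimal A B T K \<alpha> \<beta> vs \<longleftrightarrow> vs \<in> feasible1 T \<alpha> \<beta> \<and>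
     (\<exists>\<epsilon>>0. \<forall>v\<in>feasible1 T \<alpha> \<beta>.
        (\<forall>t\<in>{0..T}. norm (gramian A B T v t - gramian A B T vs t) \<le> \<epsilon> \<and>
                     norm (cumulative v t - cumulative vs t) \<le> \<epsilon>) \<longrightarrow>
        objective A B T K v \<le> objective A B T K vs)"

definition switching ::
    "real ^ 'n ^ 'n \<Rightarrow> real ^ 'p ^ 'n \<Rightarrow> real \<Rightarrow> (real ^ 'n ^ 'n \<Rightarrow> real) \<Rightarrow>
     (real \<Rightarrow> real ^ 'p) \<Rightarrow> 'p \<Rightarrow> real \<Rightarrow> real" where
  "switching A B T K v j t =
     column j B \<bullet>
       ((mat_exp ((T - t) *\<^sub>R transpose A) ** mat_grad K (gramian A B T v T)
          ** mat_exp ((T - t) *\<^sub>R A)) *v column j B)"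

text \<open>Inputs are identified when they agree almost everywhere on \<open>{0..T}\<close>. Without this
  identification the two maximizer sets never coincide when the relaxed one is nonempty: changing
  a relaxed maximizer at a single time to a fractional admissible value gives another relaxed
  maximizer, which is not binary at every time.\<close>

definition ae_class :: "real \<Rightarrow> (real \<Rightarrow> real ^ 'p) \<Rightarrow> (real \<Rightarrow> real ^ 'p) set" where
  "ae_class T v = {w \<in> borel_measurable (lebesgue_on {0..T}).
     AE t in lebesgue_on {0..T}. w t = v t}"

end

theory Submission
  imports Defs "HOL-Complex_Analysis.Conformal_Mappings"
begin

text \<open>
  The Gramian at the final time depends affinely on the control: by variation of constants it is
  \<open>G(T) = \<Sum>\<^sub>j \<integral>\<^sub>0\<^sup>T v\<^sub>j(r) P\<^sub>j(T - r) dr\<close> with \<open>P\<^sub>j(\<tau>) = e\<^bsup>A\<tau>\<^esup> b\<^sub>j b\<^sub>j\<^sup>T e\<^bsup>A\<^sup>T\<tau>\<^esup>\<close> (\<open>gramian_eq_response\<close>). Hence the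
  derivative of the objective at a control \<open>v\<close> in a direction \<open>d\<close> is \<open>\<Sum>\<^sub>j \<integral>\<^sub>0\<^sup>T d\<^sub>j q\<^sub>j\<close>, where
  \<open>q\<^sub>j\<close> is the switching function, the pairing of the gradient of \<open>K\<close> with \<open>P\<^sub>j\<close>. It vanishes when
  \<open>v\<close> is a maximizer and both \<open>v + d\<close> and \<open>v - d\<close> are feasible (\<open>first_order_condition\<close>).

  This excludes fractional values of a relaxed maximizer \<open>v\<close> without adjoint equations or
  multipliers. Suppose \<open>v\<close> is fractional on a set of positive measure. The vertices of the polytope
  of admissible control values are binary, because the sum constraint has an integral or a
  vacuous bound; so a fractional value has room in both directions along a coordinate axis \<open>e\<^sub>j\<close>
  or a difference \<open>e\<^sub>i - e\<^sub>j\<close> (\<open>non_binary_direction\<close>). By countable additivity, one such direction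
  \<open>u\<close> and one amount of room serve on a set \<open>F\<close> of positive measure. Redistributing mass in time
  within \<open>F\<close> along \<open>u\<close>, with total zero, is feasible and respects the budget of every component.
  Optimality then makes \<open>\<Sum>\<^sub>k u\<^sub>k q\<^sub>k\<close> constant almost everywhere on \<open>F\<close>. This function is \<open>q\<^sub>j\<close> or
  \<open>q\<^sub>i - q\<^sub>j\<close>, and it extends to an entire function, so by the identity theorem it is constant on
  \<open>[0, T]\<close> (\<open>switching_combination_constant\<close>), contrary to hypothesis.

  So every relaxed maximizer is almost everywhere binary (\<open>maximizer_AE_binary\<close>). Changed on a null
  set it becomes feasible for the main problem, with the same value. As the binary controls
  are exactly the relaxed controls with binary values (\<open>feasible0_iff\<close>), the optimal values of the two
  problems agree, and with them the maximizers up to null sets.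
\<close>

section \<open>The matrix exponential\<close>

lemma matrix_mult_scaleR_left: "(k *\<^sub>R X) ** Y = k *\<^sub>R (X ** Y)" for X Y :: "real ^ 'n ^ 'n"
  by (simp add: scalar_matrix_assoc)

lemma matrix_mult_scaleR_right: "X ** (k *\<^sub>R Y) = k *\<^sub>R (X ** Y)" for X Y :: "real ^ 'n ^ 'n"
  by (simp only: scalar_matrix_assoc matrix_scalar_ac)

lemma matrix_mult_add_left: "(X + Y) ** Z = X ** Z + Y ** Z" for X Y Z :: "real ^ 'n ^ 'n"
    by (simp add: matrix_matrix_mult_def vec_eq_iff distrib_right sum.distrib)

lemma bilinear_matrix_mult:
  "bilinear ((**) :: real ^ 'n ^ 'n \<Rightarrow> real ^ 'n ^ 'n \<Rightarrow> real ^ 'n ^ 'n)"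
  by (simp add: bilinear_def linear_iff matrix_mult_add_left matrix_add_ldistrib
      matrix_mult_scaleR_left matrix_mult_scaleR_right)

text \<open>A geometric bound on the powers makes the exponential series converge entrywise, over the
  reals and over the complex numbers alike. The constants absorb the norm of the identity and the
  bound of the matrix product as a bilinear map.\<close>

lemma mat_power_norm_bound:
  fixes M :: "real ^ 'n ^ 'n"
  obtains C D where "\<And>k i j. \<bar>mat_power M k $ i $ j\<bar> \<le> D * C ^ k"
proof -
  have "bounded_bilinear ((**) :: real ^ 'n ^ 'n \<Rightarrow> real ^ 'n ^ 'n \<Rightarrow> real ^ 'n ^ 'n)"
    using bilinear_matrix_mult bilinear_conv_bounded_bilinear by blast
  from bounded_bilinear.nonneg_bounded[OF this] obtain c where c: "c \<ge> 0" "\<And>(X :: real ^ 'n ^ 'n) (Y :: real ^ 'n ^ 'n). norm (X ** Y) \<le> norm X * norm Y * c"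
    by auto
  have *: "norm (mat_power M k) \<le> norm (mat 1 :: real ^ 'n ^ 'n) * (norm M * c) ^ k" for k
  proof (induction k)
    case (Suc k)
    have "norm (mat_power M (Suc k)) \<le> (norm M * c) * norm (mat_power M k)"
      using c(2)[of M "mat_power M k"] by (simp add: mult_ac)
    also have "\<dots> \<le> (norm M * c) * (norm (mat 1 :: real ^ 'n ^ 'n) * (norm M * c) ^ k)"
      using Suc c(1) by (intro mult_left_mono) auto
    finally show ?case by (simp add: mult_ac)
  qed simp
  have "\<bar>mat_power M k $ i $ j\<bar> \<le> norm (mat 1 :: real ^ 'n ^ 'n) * (norm M * c) ^ k" for k i j
    using *[of k] component_le_norm_cart[of "mat_power M k $ i" j] Finite_Cartesian_Product.norm_nth_le[of "mat_power M k" i]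
    by linarith
  then show ?thesis using that by blast
qed

text \<open>Stated for an arbitrary Banach field, since the real case gives the derivative of the
  exponential and the complex case its entire extension.\<close>

lemma summable_mat_exp_series:
  fixes z :: "'a::{real_normed_field,banach}"
  shows "summable (\<lambda>k. of_real (mat_power M k $ i $ j / fact k) * z ^ k)"
proof -
  obtain C D where CD: "\<And>k i j. \<bar>mat_power M k $ i $ j\<bar> \<le> D * C ^ k"
    by (rule mat_power_norm_bound[of M]) blast
  have "summable (\<lambda>k. D * (inverse (fact k) * (C * norm z) ^ k))"
    by (intro summable_mult summable_exp)
  then show ?thesis
  proof (rule summable_comparison_test'[where N = 0])
    fix k :: nat
    have "norm (of_real (mat_power M k $ i $ j / fact k) * z ^ k)
        = \<bar>mat_power M k $ i $ j\<bar> * (norm z ^ k / fact k)"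
      by (simp add: norm_mult norm_power norm_divide)
    also have "\<dots> \<le> (D * C ^ k) * (norm z ^ k / fact k)"
      by (intro mult_right_mono CD) simp
    finally show "norm (of_real (mat_power M k $ i $ j / fact k) * z ^ k)
        \<le> D * (inverse (fact k) * (C * norm z) ^ k)"
      by (simp add: power_mult_distrib divide_inverse mult_ac)
  qed
qed

lemma mat_power_scaleR: "mat_power (t *\<^sub>R M) k = t ^ k *\<^sub>R mat_power M k"
  by (induction k) (simp_all add: matrix_mult_scaleR_left matrix_mult_scaleR_right)

text \<open>Each entry of \<open>e\<^bsup>tM\<^esup>\<close> is a scalar power series in \<open>t\<close>, so the scalar theorem on
  differentiating power series term by term does all the analysis.\<close>

lemma mat_exp_entry_sums:
  "(\<lambda>k. mat_power M k $ i $ j / fact k * t ^ k) sums (mat_exp (t *\<^sub>R M) $ i $ j)"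
proof -
  define S where "S = (\<chi> i j. \<Sum>k. mat_power M k $ i $ j / fact k * t ^ k)"
  have entry: "(\<lambda>k. mat_power M k $ i $ j / fact k * t ^ k) sums (S $ i $ j)" for i j
    using summable_mat_exp_series[of M i j t] by (simp add: S_def summable_sums)
  have "(\<lambda>k. (1 / fact k) *\<^sub>R mat_power (t *\<^sub>R M) k) sums S"
    unfolding sums_def
  proof (intro vec_tendstoI)
    fix i j
    show "((\<lambda>n. (\<Sum>k<n. (1 / fact k) *\<^sub>R mat_power (t *\<^sub>R M) k) $ i $ j) \<longlongrightarrow> S $ i $ j) sequentially"
      using entry[of i j] by (simp add: sums_def mat_power_scaleR sum_component mult_ac)
  qed
  then have "mat_exp (t *\<^sub>R M) = S"
    by (simp add: mat_exp_def sums_iff)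
  then show ?thesis using entry by simp
qed

lemma mat_exp_0 [simp]: "mat_exp 0 = mat 1"
proof -
  have "mat_exp (0 *\<^sub>R (0 :: real ^ 'a ^ 'a)) $ i $ j = (mat 1 :: real ^ 'a ^ 'a) $ i $ j" for i j
    by (rule sums_unique2[OF mat_exp_entry_sums])
       (use powser_sums_zero[of "\<lambda>k. mat_power (0 :: real ^ 'a ^ 'a) k $ i $ j / fact k"] in simp)
  then show ?thesis by (simp add: vec_eq_iff)
qed

lemma mat_exp_has_derivative_entry:
  "((\<lambda>t. mat_exp (t *\<^sub>R M) $ i $ j) has_real_derivative (M ** mat_exp (t *\<^sub>R M)) $ i $ j) (at t)"
proof -
  define c where "c = (\<lambda>k. mat_power M k $ i $ j / fact k)"
  have "((\<lambda>t. \<Sum>k. c k * t ^ k) has_field_derivative (\<Sum>k. diffs c k * t ^ k)) (at t)"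
  proof (intro termdiffs_strong_converges_everywhere)
    show "summable (\<lambda>k. c k * y ^ k)" for y
      using summable_mat_exp_series[of M i j y] by (simp add: c_def)
  qed
  moreover have "(\<lambda>t. \<Sum>k. c k * t ^ k) = (\<lambda>t. mat_exp (t *\<^sub>R M) $ i $ j)"
    using mat_exp_entry_sums[of M i j] by (simp add: c_def sums_iff)
  moreover have "(\<Sum>k. diffs c k * t ^ k) = (M ** mat_exp (t *\<^sub>R M)) $ i $ j"
  proof -
    have "(\<lambda>k. \<Sum>l\<in>UNIV. M $ i $ l * (mat_power M k $ l $ j / fact k * t ^ k))
        sums (\<Sum>l\<in>UNIV. M $ i $ l * mat_exp (t *\<^sub>R M) $ l $ j)"
      by (intro sums_sum sums_mult mat_exp_entry_sums)
    moreover have "diffs c k * t ^ k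
        = (\<Sum>l\<in>UNIV. M $ i $ l * (mat_power M k $ l $ j / fact k * t ^ k))" for k
    proof -
      have "diffs c k = mat_power M (Suc k) $ i $ j / fact k"
        unfolding diffs_def c_def fact_Suc by (simp del: mat_power.simps of_nat_Suc)
      then show ?thesis
        by (simp add: matrix_matrix_mult_def sum_distrib_right sum_divide_distrib mult.assoc)
    qed
    ultimately show ?thesis
      by (simp only: sums_iff matrix_matrix_mult_def vec_lambda_beta)
  qed
  ultimately show ?thesis by simp
qed

lemma matrix_mult_mat_power_commute: "M ** mat_power M k = mat_power M k ** M"
proof (induction k)
  case (Suc k)
  then show ?case by (metis mat_power.simps(2) matrix_mul_assoc)
qed simp

lemma mat_power_transpose: "mat_power (transpose M) k = transpose (mat_power M k)"
proof (induction k)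
  case (Suc k)
  then have "mat_power (transpose M) (Suc k) = transpose (mat_power M k ** M)"
    by (simp add: matrix_transpose_mul)
  then show ?case by (simp only: matrix_mult_mat_power_commute[symmetric] mat_power.simps)
qed (simp add: transpose_mat)

lemma mat_exp_transpose: "mat_exp (t *\<^sub>R transpose M) = transpose (mat_exp (t *\<^sub>R M))"
proof -
  have "mat_exp (t *\<^sub>R transpose M) $ i $ j = transpose (mat_exp (t *\<^sub>R M)) $ i $ j" for i j
  proof (rule sums_unique2)
    show "(\<lambda>k. mat_power (transpose M) k $ i $ j / fact k * t ^ k) sums mat_exp (t *\<^sub>R transpose M) $ i $ j"
      by (rule mat_exp_entry_sums)
    have "(\<lambda>k. mat_power M k $ j $ i / fact k * t ^ k) sums mat_exp (t *\<^sub>R M) $ j $ i"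
      by (rule mat_exp_entry_sums)
    then show "(\<lambda>k. mat_power (transpose M) k $ i $ j / fact k * t ^ k) sums transpose (mat_exp (t *\<^sub>R M)) $ i $ j"
      by (simp only: mat_power_transpose) (simp add: transpose_def)
  qed
  then show ?thesis by (simp add: vec_eq_iff)
qed

section \<open>Real functions with an entire extension\<close>

text \<open>Real analyticity of the switching functions enters only through the identity theorem, and this form makes the complex version applicable while
  its closure under ring operations is immediate.\<close>

definition entire_real :: "(real \<Rightarrow> real) \<Rightarrow> bool" where
  "entire_real g \<longleftrightarrow> (\<exists>f. f holomorphic_on UNIV \<and> (\<forall>t. f (complex_of_real t) = complex_of_real (g t)))"

lemma entire_real_const: "entire_real (\<lambda>_. c)"
  unfolding entire_real_def by (intro exI[of _ "\<lambda>_. of_real c"]) auto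

lemma entire_real_mult: "entire_real f \<Longrightarrow> entire_real g \<Longrightarrow> entire_real (\<lambda>t. f t * g t)"
  unfolding entire_real_def
  by (elim exE conjE, rename_tac F G, rule_tac x = "\<lambda>z. F z * G z" in exI)
     (auto intro: holomorphic_intros)

lemma entire_real_add: "entire_real f \<Longrightarrow> entire_real g \<Longrightarrow> entire_real (\<lambda>t. f t + g t)"
  unfolding entire_real_def
  by (elim exE conjE, rename_tac F G, rule_tac x = "\<lambda>z. F z + G z" in exI)
     (auto intro: holomorphic_intros)

lemma entire_real_sum: "(\<And>i. i \<in> I \<Longrightarrow> entire_real (f i)) \<Longrightarrow> entire_real (\<lambda>t. \<Sum>i\<in>I. f i t)"
  by (induction I rule: infinite_finite_induct) (auto intro: entire_real_const entire_real_add)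

lemma entire_real_reflect:
  assumes "entire_real f"
  shows "entire_real (\<lambda>t. f (c - t))"
proof -
  obtain F where F: "F holomorphic_on UNIV" "\<And>t. F (complex_of_real t) = complex_of_real (f t)"
    using assms by (auto simp: entire_real_def)
  have "(F \<circ> (\<lambda>z. of_real c - z)) holomorphic_on UNIV"
    by (intro holomorphic_on_compose_gen[OF _ F(1)] holomorphic_intros) auto
  moreover have "(F \<circ> (\<lambda>z. of_real c - z)) (of_real t) = of_real (f (c - t))" for t
    using F(2)[of "c - t"] by simp
  ultimately show ?thesis unfolding entire_real_def by blast
qed

lemma entire_real_mat_exp_entry: "entire_real (\<lambda>t. mat_exp (t *\<^sub>R M) $ i $ j)"
proof -
  define c where "c = (\<lambda>k. complex_of_real (mat_power M k $ i $ j / fact k))"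
  have "summable (\<lambda>k. c k * z ^ k)" for z
    using summable_mat_exp_series[of M i j z] by (simp add: c_def)
  then have "((\<lambda>z. \<Sum>k. c k * z ^ k) has_field_derivative (\<Sum>k. diffs c k * z ^ k)) (at z)" for z
    by (intro termdiffs_strong_converges_everywhere) auto
  then have "(\<lambda>z. \<Sum>k. c k * z ^ k) holomorphic_on UNIV"
    by (auto simp: holomorphic_on_def field_differentiable_def)
  moreover have "(\<Sum>k. c k * of_real t ^ k) = of_real (mat_exp (t *\<^sub>R M) $ i $ j)" for t
  proof -
    have "(\<lambda>k. complex_of_real (mat_power M k $ i $ j / fact k * t ^ k))
        sums of_real (mat_exp (t *\<^sub>R M) $ i $ j)"
      by (intro sums_of_real mat_exp_entry_sums)
    then show ?thesis by (simp add: c_def sums_iff)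
  qed
  ultimately show ?thesis unfolding entire_real_def by blast
qed

lemma continuous_on_entire_real:
  assumes "entire_real g"
  shows "continuous_on S g"
proof -
  obtain f where f: "f holomorphic_on UNIV" "\<And>t. f (complex_of_real t) = complex_of_real (g t)"
    using assms by (auto simp: entire_real_def)
  have "continuous_on S (\<lambda>t. Re (f (complex_of_real t)))"
    by (intro continuous_intros continuous_on_compose2[OF holomorphic_on_imp_continuous_on[OF f(1)]]) auto
  then show ?thesis by (simp add: f(2))
qed

text \<open>Infinitely many points in a compact interval accumulate, so the identity theorem applies
  to the entire extension minus \<open>c\<close>.\<close>

lemma entire_real_constant_if_infinite_level:
  assumes "entire_real g" "infinite {t \<in> {a..b}. g t = c}"
  shows "g t = c"
proof -
  obtain f where f: "f holomorphic_on UNIV" "\<And>t. f (complex_of_real t) = complex_of_real (g t)"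
    using assms(1) by (auto simp: entire_real_def)
  have "compact {a..b}" by simp
  then obtain x where x: "x islimpt {t \<in> {a..b}. g t = c}"
    using Heine_Borel_imp_Bolzano_Weierstrass[OF _ assms(2)] by blast
  define U where "U = complex_of_real ` {t \<in> {a..b}. g t = c}"
  have "complex_of_real x islimpt U"
    unfolding islimpt_approachable
  proof (intro allI impI)
    fix e :: real assume "e > 0"
    then obtain y where "y \<in> {t \<in> {a..b}. g t = c}" "y \<noteq> x" "dist y x < e"
      using x unfolding islimpt_approachable by blast
    then show "\<exists>x'\<in>U. x' \<noteq> complex_of_real x \<and> dist x' (complex_of_real x) < e"
      unfolding U_def by (intro bexI[of _ "of_real y"]) (auto simp: dist_of_real)
  qed
  moreover have "(\<lambda>z. f z - of_real c) holomorphic_on UNIV"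
    using f(1) by (intro holomorphic_intros)
  ultimately have "f (of_real t) - of_real c = 0"
    using f(2) by (elim analytic_continuation[rotated 5]) (auto simp: U_def)
  then show ?thesis using f(2)[of t] by simp
qed

section \<open>Impulse responses and the switching functions\<close>

text \<open>The rank-one matrix \<open>e\<^bsup>A\<tau>\<^esup> b b\<^sup>T e\<^bsup>A\<^sup>T\<tau>\<^esup>\<close>: what a unit of input through the column
  \<open>b\<close> contributes to the Gramian when \<open>\<tau>\<close> time units have passed since.\<close>

definition impulse_gramian :: "real ^ 'n ^ 'n \<Rightarrow> real ^ 'n \<Rightarrow> real \<Rightarrow> real ^ 'n ^ 'n" where
  "impulse_gramian A b \<tau> = (\<chi> i k. (mat_exp (\<tau> *\<^sub>R A) *v b) $ i * (mat_exp (\<tau> *\<^sub>R A) *v b) $ k)"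

definition lyap_op :: "real ^ 'n ^ 'n \<Rightarrow> real ^ 'n ^ 'n \<Rightarrow> real ^ 'n ^ 'n" where
  "lyap_op A G = A ** G + G ** transpose A"

lemma bounded_linear_lyap_op: "bounded_linear (lyap_op (A :: real ^ 'n ^ 'n))"
proof (rule linear_conv_bounded_linear[THEN iffD1], rule linearI)
  fix X Y :: "real ^ 'n ^ 'n" and r :: real
  show "lyap_op A (X + Y) = lyap_op A X + lyap_op A Y"
    by (simp only: lyap_op_def matrix_mult_add_left matrix_add_ldistrib ac_simps)
  show "lyap_op A (r *\<^sub>R X) = r *\<^sub>R lyap_op A X"
    by (simp only: lyap_op_def matrix_mult_scaleR_left matrix_mult_scaleR_right scaleR_add_right)
qed

text \<open>Stated for vectors over a Euclidean space, so that applying it twice treats matrices.\<close>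

lemma has_vector_derivative_cart:
  fixes f :: "real \<Rightarrow> 'a::euclidean_space ^ 'n"
  assumes "\<And>i. ((\<lambda>t. f t $ i) has_vector_derivative f' $ i) (at x within S)"
  shows "(f has_vector_derivative f') (at x within S)"
  unfolding has_vector_derivative_def has_derivative_componentwise_within[of f]
proof (rule ballI)
  fix u :: "'a ^ 'n" assume "u \<in> Basis"
  then obtain i w where u: "u = axis i w" unfolding Basis_vec_def by blast
  show "((\<lambda>t. f t \<bullet> u) has_derivative (\<lambda>h. (h *\<^sub>R f') \<bullet> u)) (at x within S)"
    using has_derivative_inner_left[OF assms[of i, unfolded has_vector_derivative_def], of w]
    by (simp only: u inner_axis vector_scaleR_component)
qed

lemma impulse_gramian_derivative:
  "(impulse_gramian A b has_vector_derivative lyap_op A (impulse_gramian A b t)) (at t within S)"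
proof (intro has_vector_derivative_cart)
  fix i k
  define x where "x = (\<lambda>t. mat_exp (t *\<^sub>R A) *v b)"
  have x': "((\<lambda>t. x t $ l) has_real_derivative (A *v x t) $ l) (at t within S)" for l
  proof -
    have "((\<lambda>t. \<Sum>m\<in>UNIV. mat_exp (t *\<^sub>R A) $ l $ m * b $ m) has_real_derivative
        (\<Sum>m\<in>UNIV. (A ** mat_exp (t *\<^sub>R A)) $ l $ m * b $ m)) (at t within S)"
      by (intro DERIV_sum DERIV_cmult_right
          mat_exp_has_derivative_entry[THEN has_field_derivative_at_within])
    then show ?thesis
      unfolding x_def matrix_vector_mul_assoc by (simp add: matrix_vector_mult_def)
  qed
  have d: "((\<lambda>t. x t $ i * x t $ k) has_real_derivative
      (A *v x t) $ i * x t $ k + (A *v x t) $ k * x t $ i) (at t within S)"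
    by (intro DERIV_mult x')
  have gram: "impulse_gramian A b t = (\<chi> i k. x t $ i * x t $ k)"
    by (simp add: impulse_gramian_def x_def)
  have eq: "(A *v x t) $ i * x t $ k + (A *v x t) $ k * x t $ i
      = lyap_op A (impulse_gramian A b t) $ i $ k"
    unfolding lyap_op_def gram matrix_vector_mult_def[of A]
    by (simp add: matrix_matrix_mult_def transpose_def sum_distrib_left sum_distrib_right mult_ac)
  show "((\<lambda>t. impulse_gramian A b t $ i $ k) has_vector_derivative
      lyap_op A (impulse_gramian A b t) $ i $ k) (at t within S)"
    using d[unfolded eq has_real_derivative_iff_has_vector_derivative]
    by (simp add: impulse_gramian_def x_def)
qed

lemma continuous_on_impulse_gramian: "continuous_on S (impulse_gramian A b)"
  by (rule continuous_on_vector_derivative, rule impulse_gramian_derivative)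

lemma entire_real_inner_impulse_gramian: "entire_real (\<lambda>t. M \<bullet> impulse_gramian A b t)"
  unfolding inner_vec_def impulse_gramian_def matrix_vector_mult_def
  by (simp add: inner_real_def, intro entire_real_sum entire_real_mult entire_real_const entire_real_mat_exp_entry)

text \<open>Moving the factors of the quadratic form through the trace exhibits the switching function
  as the pairing of the gradient with the response to an impulse at time \<open>t\<close>. This identifies it
  with the density of the derivative of the objective, and it shows that it is analytic.\<close>

lemma switching_eq_inner:
  "switching A B T K v j t =
     mat_grad K (gramian A B T v T) \<bullet> impulse_gramian A (column j B) (T - t)"
proof -
  define M where "M = mat_grad K (gramian A B T v T)"
  define E where "E = mat_exp ((T - t) *\<^sub>R A)"
  define b where "b = column j B"
  have "switching A B T K v j t = b \<bullet> (transpose E *v (M *v (E *v b)))"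
    by (simp add: switching_def mat_exp_transpose M_def E_def b_def matrix_vector_mul_assoc matrix_mul_assoc)
  also have "\<dots> = (E *v b) \<bullet> (M *v (E *v b))"
    by (simp only: transpose_matrix_vector inner_commute[of b] dot_lmul_matrix) (rule inner_commute)
  also have "\<dots> = M \<bullet> impulse_gramian A b (T - t)"
    by (simp add: inner_vec_def impulse_gramian_def E_def[symmetric] matrix_vector_mult_def[of M]
        sum_distrib_left mult_ac)
  finally show ?thesis by (simp add: M_def b_def)
qed

section \<open>Convolutions with measurable inputs\<close>

lemma finite_measure_lebesgue_on_Icc: "finite_measure (lebesgue_on {a..b::real})"
  by (intro finite_measure_lebesgue_on) simp

lemma integrable_scaleR_continuous:
  fixes w :: "real \<Rightarrow> real" and f :: "real \<Rightarrow> 'a::euclidean_space"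
  assumes w: "w \<in> borel_measurable (lebesgue_on {a..b})" "\<And>r. r \<in> {a..b} \<Longrightarrow> \<bar>w r\<bar> \<le> C"
    and f: "continuous_on {a..b} f"
  shows "integrable (lebesgue_on {a..b}) (\<lambda>r. w r *\<^sub>R f r)"
proof -
  interpret finite_measure "lebesgue_on {a..b}"
    by (rule finite_measure_lebesgue_on_Icc)
  obtain D where D: "\<And>r. r \<in> {a..b} \<Longrightarrow> norm (f r) \<le> D"
    using compact_imp_bounded[OF compact_continuous_image[OF f compact_Icc]]
    by (fastforce simp: bounded_iff)
  show ?thesis
  proof (rule integrable_const_bound)
    show "AE r in lebesgue_on {a..b}. norm (w r *\<^sub>R f r) \<le> C * D"
    proof (rule AE_I2)
      fix r assume "r \<in> space (lebesgue_on {a..b})"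
      then have "r \<in> {a..b}" by simp
      with w(2) D have "\<bar>w r\<bar> * norm (f r) \<le> C * D"
        by (intro mult_mono) (auto intro: order_trans[OF abs_ge_zero])
      then show "norm (w r *\<^sub>R f r) \<le> C * D" by simp
    qed
    have "f \<in> borel_measurable (lebesgue_on {a..b})"
      using f by (intro continuous_imp_measurable_on_sets_lebesgue) simp_all
    then show "(\<lambda>r. w r *\<^sub>R f r) \<in> borel_measurable (lebesgue_on {a..b})"
      using w(1) by (intro borel_measurable_scaleR)
  qed
qed

text \<open>For a merely measurable input the convolution \<open>\<integral>\<^sub>0\<^sup>t w(r) P(t - r) dr\<close> need not be
  differentiable at every time, so its
  derivative is stated in integrated form. Exchanging the integrals over the triangle
  \<open>0 \<le> r \<le> s \<le> t\<close> leaves \<open>P'\<close> as the inner integrand, where the fundamental theorem of calculus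
  applies to a smooth function.\<close>

lemma convolution_derivative:
  fixes w :: "real \<Rightarrow> real" and P P' :: "real \<Rightarrow> 'a::euclidean_space"
  assumes w: "w \<in> borel_measurable (lebesgue_on {0..t})" "\<And>r. r \<in> {0..t} \<Longrightarrow> \<bar>w r\<bar> \<le> C"
    and P': "continuous_on UNIV P'" and P: "\<And>s. (P has_vector_derivative P' s) (at s)"
  shows "integrable (lebesgue_on {0..t}) (\<lambda>s. LINT r|lebesgue_on {0..s}. w r *\<^sub>R P' (s - r))" (is ?int)
    and "(LINT s|lebesgue_on {0..t}. LINT r|lebesgue_on {0..s}. w r *\<^sub>R P' (s - r)) =
         (LINT r|lebesgue_on {0..t}. w r *\<^sub>R (P (t - r) - P 0))" (is ?eq)
proof -
  let ?M = "lebesgue_on {0..t}"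
  \<comment> \<open>the integrand on the triangle \<open>r \<le> s\<close>, extended by zero to the square\<close>
  define F where "F = (\<lambda>s r. if r \<le> s then w r *\<^sub>R P' (s - r) else 0)"
  interpret M: finite_measure ?M
    by (rule finite_measure_lebesgue_on_Icc)
  interpret MM: pair_sigma_finite ?M ?M ..
  interpret prod: finite_measure "?M \<Otimes>\<^sub>M ?M"
    by (rule finite_measure_pair_measure) unfold_locales
  have F_int: "integrable (?M \<Otimes>\<^sub>M ?M) (case_prod F)"
  proof -
    have "continuous_on {0..t} P'"
      using P' continuous_on_subset by blast
    then obtain D where D: "\<And>r. r \<in> {0..t} \<Longrightarrow> norm (P' r) \<le> D"
      using compact_imp_bounded[OF compact_continuous_image[OF _ compact_Icc]]
      by (fastforce simp: bounded_iff)
    have "AE z in ?M \<Otimes>\<^sub>M ?M. norm (case_prod F z) \<le> C * D"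
    proof (rule AE_I2)
      fix z assume "z \<in> space (?M \<Otimes>\<^sub>M ?M)"
      then obtain s r where z: "z = (s, r)" and sr: "s \<in> {0..t}" "r \<in> {0..t}"
        by (auto simp: space_pair_measure)
      have CD: "0 \<le> C" "0 \<le> D"
        using w(2)[OF sr(2)] D[OF sr(1)] by (auto intro: order_trans[OF abs_ge_zero] order_trans[OF norm_ge_zero])
      have "\<bar>w r\<bar> * norm (P' (s - r)) \<le> C * D" if "r \<le> s"
        using that sr CD by (intro mult_mono w(2) D) auto
      then show "norm (case_prod F z) \<le> C * D"
        using CD by (simp add: z F_def)
    qed
    moreover have "case_prod F \<in> borel_measurable (?M \<Otimes>\<^sub>M ?M)"
    proof -
      have id: "(\<lambda>x. x) \<in> borel_measurable ?M"
        using id_borel_measurable_lebesgue_on[of "{0..t}"] by (simp add: id_def)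
      have [measurable]: "fst \<in> borel_measurable (?M \<Otimes>\<^sub>M ?M)" "snd \<in> borel_measurable (?M \<Otimes>\<^sub>M ?M)"
        by (rule measurable_compose[OF measurable_fst id, simplified], rule measurable_compose[OF measurable_snd id, simplified])
      have [measurable]: "(\<lambda>z. w (snd z)) \<in> borel_measurable (?M \<Otimes>\<^sub>M ?M)"
        by (rule measurable_compose[OF measurable_snd w(1)])
      have [measurable]: "P' \<in> borel_measurable borel"
        using P' by (rule borel_measurable_continuous_onI)
      have "case_prod F = (\<lambda>z. if snd z \<le> fst z then w (snd z) *\<^sub>R P' (fst z - snd z) else 0)"
        by (auto simp: F_def fun_eq_iff)
      then show ?thesis by simp
    qed
    ultimately show ?thesis by (rule prod.integrable_const_bound)
  qed
  have inner_r: "(LINT r|?M. F s r) = (LINT r|lebesgue_on {0..s}. w r *\<^sub>R P' (s - r))"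
    if "s \<in> {0..t}" for s
  proof -
    have "(LINT r|?M. F s r) = (LINT r|?M. (if r \<in> {0..s} then w r *\<^sub>R P' (s - r) else 0))"
      by (intro Bochner_Integration.integral_cong) (auto simp: F_def)
    also have "\<dots> = (LINT r|lebesgue_on {0..s}. w r *\<^sub>R P' (s - r))"
      using that by (intro Lebesgue_Measure.integral_restrict) auto
    finally show ?thesis .
  qed
  have inner_s: "(LINT s|?M. F s r) = w r *\<^sub>R (P (t - r) - P 0)" if r: "r \<in> {0..t}" for r
  proof -
    have "(LINT s|?M. F s r) = (LINT s|?M. (if s \<in> {r..t} then w r *\<^sub>R P' (s - r) else 0))"
      using r by (intro Bochner_Integration.integral_cong) (auto simp: F_def)
    also have "\<dots> = (LINT s|lebesgue_on {r..t}. w r *\<^sub>R P' (s - r))"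
      using r by (intro Lebesgue_Measure.integral_restrict) auto
    also have "\<dots> = w r *\<^sub>R (LINT s|lebesgue_on {r..t}. P' (s - r))"
      by simp
    also have "(LINT s|lebesgue_on {r..t}. P' (s - r)) = integral {r..t} (\<lambda>s. P' (s - r))"
      by (intro lebesgue_integral_eq_integral continuous_imp_integrable_real
          continuous_on_compose2[OF P'] continuous_intros) auto
    also have "\<dots> = P (t - r) - P (r - r)"
    proof (intro integral_unique fundamental_theorem_of_calculus)
      fix s
      have "((\<lambda>s. s - r) has_vector_derivative 1) (at s)"
        by (auto intro!: derivative_eq_intros)
      from vector_diff_chain_at[OF this P]
      have "((\<lambda>s. P (s - r)) has_vector_derivative P' (s - r)) (at s)"
        by (simp add: o_def)
      then show "((\<lambda>s. P (s - r)) has_vector_derivative P' (s - r)) (at s within {r..t})"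
        by (rule has_vector_derivative_at_within)
    qed (use r in simp)
    finally show ?thesis by simp
  qed
  have "?int \<longleftrightarrow> integrable ?M (\<lambda>s. LINT r|?M. F s r)"
  proof (rule Bochner_Integration.integrable_cong[OF refl])
    show "(LINT r|lebesgue_on {0..s}. w r *\<^sub>R P' (s - r)) = (LINT r|?M. F s r)"
      if "s \<in> space ?M" for s
      by (rule inner_r[symmetric]) (use that in simp)
  qed
  then show ?int
    using MM.integrable_fst'[OF F_int] by simp
  have "(LINT s|?M. LINT r|lebesgue_on {0..s}. w r *\<^sub>R P' (s - r)) = (LINT s|?M. LINT r|?M. F s r)"
    by (rule Bochner_Integration.integral_cong[OF refl inner_r[symmetric]]) simp
  also have "\<dots> = (LINT r|?M. LINT s|?M. F s r)"
    by (rule MM.Fubini_integral[OF F_int, symmetric])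
  also have "\<dots> = (LINT r|?M. w r *\<^sub>R (P (t - r) - P 0))"
    by (rule Bochner_Integration.integral_cong[OF refl inner_s]) simp
  finally show ?eq .
qed

section \<open>The solution of the Lyapunov equation\<close>

definition bounded_input :: "real \<Rightarrow> (real \<Rightarrow> real ^ 'p) \<Rightarrow> bool" where
  "bounded_input T v \<longleftrightarrow> v \<in> borel_measurable (lebesgue_on {0..T}) \<and>
     (\<exists>C. \<forall>t\<in>{0..T}. \<forall>j. \<bar>v t $ j\<bar> \<le> C)"

lemma bounded_inputI:
  assumes "v \<in> borel_measurable (lebesgue_on {0..T})" "\<And>t j. t \<in> {0..T} \<Longrightarrow> \<bar>v t $ j\<bar> \<le> C"
  shows "bounded_input T v"
  using assms unfolding bounded_input_def by blast

lemma bounded_inputD: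
  fixes v :: "real \<Rightarrow> real ^ 'p"
  assumes "bounded_input T v"
  obtains C where "\<And>t j. t \<in> {0..T} \<Longrightarrow> \<bar>v t $ j\<bar> \<le> C"
    and "\<And>j. (\<lambda>t. v t $ j) \<in> borel_measurable (lebesgue_on {0..T})"
proof -
  have "(\<lambda>t. v t $ j) \<in> borel_measurable (lebesgue_on {0..T})" for j
    using assms borel_measurable_continuous_onI[of "\<lambda>x :: real ^ 'p. x $ j"]
    by (auto simp: bounded_input_def intro!: measurable_compose[of v _ borel] continuous_intros)
  then show ?thesis
    using assms that unfolding bounded_input_def by blast
qed

lemma bounded_input_mono:
  assumes "bounded_input T v" "t \<in> {0..T}"
  shows "bounded_input t v"
  using assms measurable_restrict_mono[of v lebesgue "{0..T}" borel "{0..t}"]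
  by (fastforce simp: bounded_input_def)

text \<open>Variation of constants: the Gramian as the superposition of the impulse responses.\<close>

definition response ::
    "real ^ 'n ^ 'n \<Rightarrow> real ^ 'p ^ 'n \<Rightarrow> (real \<Rightarrow> real ^ 'p) \<Rightarrow> real \<Rightarrow> real ^ 'n ^ 'n" where
  "response A B v t =
     (\<Sum>j\<in>UNIV. LINT r|lebesgue_on {0..t}. v r $ j *\<^sub>R impulse_gramian A (column j B) (t - r))"

lemma integrable_response_kernel:
  assumes "bounded_input t v" "continuous_on UNIV (P :: real \<Rightarrow> 'a::euclidean_space)"
  shows "integrable (lebesgue_on {0..t}) (\<lambda>r. v r $ j *\<^sub>R P (t - r))"
proof -
  obtain C where C: "\<And>s j. s \<in> {0..t} \<Longrightarrow> \<bar>v s $ j\<bar> \<le> C"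
    "\<And>j. (\<lambda>t. v t $ j) \<in> borel_measurable (lebesgue_on {0..t})"
    by (rule bounded_inputD[OF assms(1)]) blast
  show ?thesis
    by (rule integrable_scaleR_continuous[OF C(2) C(1)])
       (auto intro!: continuous_on_compose2[OF assms(2)] continuous_intros)
qed

text \<open>The input matrix \<open>B V B\<^sup>T\<close> is the superposition of the impulse responses at age zero.\<close>

lemma lyap_rhs_eq:
  "lyap_rhs A B w G = lyap_op A G + (\<Sum>j\<in>UNIV. w $ j *\<^sub>R impulse_gramian A (column j B) 0)"
proof -
  have "B ** diag_mat w ** transpose B = (\<Sum>j\<in>UNIV. w $ j *\<^sub>R impulse_gramian A (column j B) 0)"
  proof -
    have "(B ** diag_mat w ** transpose B) $ i $ k =
        (\<Sum>j\<in>UNIV. w $ j *\<^sub>R impulse_gramian A (column j B) 0) $ i $ k" for i k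
      by (simp add: matrix_matrix_mult_def diag_mat_def transpose_def impulse_gramian_def
          column_def sum_component if_distrib[of "\<lambda>x. _ * x"] cong: if_cong)
         (simp add: mult_ac)
    then show ?thesis by (simp add: vec_eq_iff)
  qed
  then show ?thesis by (simp add: lyap_rhs_def lyap_op_def)
qed

lemma continuous_on_lyap_op: "continuous_on S f \<Longrightarrow> continuous_on S (\<lambda>x. lyap_op A (f x))"
  by (rule bounded_linear.continuous_on[OF bounded_linear_lyap_op])

lemma lyap_op_response:
  assumes "bounded_input t v"
  shows "lyap_op A (response A B v t) = (\<Sum>j\<in>UNIV. LINT r|lebesgue_on {0..t}.
           v r $ j *\<^sub>R lyap_op A (impulse_gramian A (column j B) (t - r)))"
proof -
  interpret L: bounded_linear "lyap_op A" by (rule bounded_linear_lyap_op)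
  show ?thesis
    unfolding response_def L.sum
  proof (rule sum.cong[OF refl])
    fix j
    show "lyap_op A (LINT r|lebesgue_on {0..t}. v r $ j *\<^sub>R impulse_gramian A (column j B) (t - r)) =
        (LINT r|lebesgue_on {0..t}. v r $ j *\<^sub>R lyap_op A (impulse_gramian A (column j B) (t - r)))"
      using integral_bounded_linear[OF bounded_linear_lyap_op
          integrable_response_kernel[OF assms continuous_on_impulse_gramian], of A j A "column j B"]
      by (simp add: L.scaleR)
  qed
qed

text \<open>Each impulse response \<open>P\<close> satisfies \<open>P' = L P\<close> with \<open>L\<close> the Lyapunov operator. Integrating \<open>L\<close> applied to the
  superposition therefore integrates a convolution with \<open>P'\<close>, which returns the superposition
  itself minus the integral of the input term, as the Caratheodory equation demands.\<close>

lemma lyap_solution_response: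
  fixes A :: "real ^ 'n ^ 'n" and B :: "real ^ 'p ^ 'n"
  assumes v: "bounded_input T v"
  shows "lyap_solution A B T v (response A B v)"
proof -
  define P where "P = (\<lambda>j. impulse_gramian A (column j B))"
  define P' where "P' = (\<lambda>j s. lyap_op A (P j s))"
  have P: "(P j has_vector_derivative P' j s) (at s)" for j s
    unfolding P_def P'_def by (rule impulse_gramian_derivative)
  have contP: "continuous_on UNIV (P j)" and contP': "continuous_on UNIV (P' j)" for j
    unfolding P_def P'_def by (intro continuous_on_lyap_op continuous_on_impulse_gramian)+
  have conv: "integrable (lebesgue_on {0..t}) (\<lambda>s. LINT r|lebesgue_on {0..s}. v r $ j *\<^sub>R P' j (s - r))"
      "(LINT s|lebesgue_on {0..t}. LINT r|lebesgue_on {0..s}. v r $ j *\<^sub>R P' j (s - r)) =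
         (LINT r|lebesgue_on {0..t}. v r $ j *\<^sub>R (P j (t - r) - P j 0))"
    if t: "t \<in> {0..T}" for t j
  proof -
    obtain C where C: "\<And>s j. s \<in> {0..t} \<Longrightarrow> \<bar>v s $ j\<bar> \<le> C"
      "\<And>j. (\<lambda>t. v t $ j) \<in> borel_measurable (lebesgue_on {0..t})"
      by (rule bounded_inputD[OF bounded_input_mono[OF v t]]) blast
    show "integrable (lebesgue_on {0..t}) (\<lambda>s. LINT r|lebesgue_on {0..s}. v r $ j *\<^sub>R P' j (s - r))"
      "(LINT s|lebesgue_on {0..t}. LINT r|lebesgue_on {0..s}. v r $ j *\<^sub>R P' j (s - r)) =
         (LINT r|lebesgue_on {0..t}. v r $ j *\<^sub>R (P j (t - r) - P j 0))"
      using convolution_derivative[OF C(2)[of j] C(1) contP'[of j] P] by blast+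
  qed
  have input: "integrable (lebesgue_on {0..t}) (\<lambda>r. v r $ j *\<^sub>R P j 0)" if "t \<in> {0..T}" for t j
    using integrable_response_kernel[OF bounded_input_mono[OF v that], of "\<lambda>_. P j 0"] by simp
  have rhs: "lyap_rhs A B (v s) (response A B v s) =
      (\<Sum>j\<in>UNIV. (LINT r|lebesgue_on {0..s}. v r $ j *\<^sub>R P' j (s - r)) + v s $ j *\<^sub>R P j 0)"
    if "s \<in> {0..T}" for s
    by (simp add: lyap_rhs_eq lyap_op_response[OF bounded_input_mono[OF v that]] P'_def P_def sum.distrib)
  have "integrable (lebesgue_on {0..T}) (\<lambda>s. lyap_rhs A B (v s) (response A B v s))"
  proof (cases "0 \<le> T")
    case True
    have "integrable (lebesgue_on {0..T}) (\<lambda>s. lyap_rhs A B (v s) (response A B v s)) \<longleftrightarrow>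
        integrable (lebesgue_on {0..T})
      (\<lambda>s. \<Sum>j\<in>UNIV. (LINT r|lebesgue_on {0..s}. v r $ j *\<^sub>R P' j (s - r)) + v s $ j *\<^sub>R P j 0)"
      by (rule Bochner_Integration.integrable_cong) (simp_all add: rhs)
    moreover have "\<dots>"
      using True by (intro Bochner_Integration.integrable_sum Bochner_Integration.integrable_add conv input) auto
    ultimately show ?thesis by blast
  qed simp
  moreover have "response A B v t = (LINT s|lebesgue_on {0..t}. lyap_rhs A B (v s) (response A B v s))"
    if t: "t \<in> {0..T}" for t
  proof -
    have "(LINT s|lebesgue_on {0..t}. lyap_rhs A B (v s) (response A B v s)) =
      (LINT s|lebesgue_on {0..t}. (\<Sum>j\<in>UNIV. (LINT r|lebesgue_on {0..s}. v r $ j *\<^sub>R P' j (s - r)) + v s $ j *\<^sub>R P j 0))"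
      using t by (intro Bochner_Integration.integral_cong) (auto simp: rhs)
    also have "\<dots> = (\<Sum>j\<in>UNIV. (LINT r|lebesgue_on {0..t}. v r $ j *\<^sub>R (P j (t - r) - P j 0))
        + (LINT s|lebesgue_on {0..t}. v s $ j *\<^sub>R P j 0))"
      using conv[OF t] input[OF t] by (simp add: Bochner_Integration.integral_sum)
    also have "\<dots> = (\<Sum>j\<in>UNIV. LINT r|lebesgue_on {0..t}. v r $ j *\<^sub>R P j (t - r))"
    proof (rule sum.cong[OF refl])
      fix j
      show "(LINT r|lebesgue_on {0..t}. v r $ j *\<^sub>R (P j (t - r) - P j 0))
        + (LINT s|lebesgue_on {0..t}. v s $ j *\<^sub>R P j 0) = (LINT r|lebesgue_on {0..t}. v r $ j *\<^sub>R P j (t - r))"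
        using input[OF t, of j] integrable_response_kernel[OF bounded_input_mono[OF v t] contP, of j j]
        by (simp add: scaleR_diff_right)
    qed
    finally show ?thesis by (simp add: response_def P_def)
  qed
  ultimately show ?thesis by (simp add: lyap_solution_def)
qed

text \<open>Uniqueness for Caratheodory solutions of a linear equation. The integral equation makes
  \<open>D\<close> continuous, hence the integrand is continuous and \<open>D\<close> is differentiable after all. If \<open>C\<close>
  bounds \<open>L\<close>, the energy \<open>e\<^bsup>-2Ct\<^esup> |D(t)|\<^sup>2\<close> cannot increase, and it starts at zero.\<close>

lemma linear_ode_zero:
  fixes D :: "real \<Rightarrow> 'a::euclidean_space"
  assumes L: "bounded_linear L"
    and int: "integrable (lebesgue_on {0..T}) (\<lambda>s. L (D s))"
    and eq: "\<And>t. t \<in> {0..T} \<Longrightarrow> D t = (LINT s|lebesgue_on {0..t}. L (D s))"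
    and t: "t \<in> {0..T}"
  shows "D t = 0"
proof -
  have D_eq: "D u = integral {0..u} (\<lambda>s. L (D s))" if "u \<in> {0..T}" for u
  proof -
    have "integrable (lebesgue_on {0..u}) (\<lambda>s. L (D s))"
      using that by (intro Equivalence_Lebesgue_Henstock_Integration.integrable_subinterval[OF int]) auto
    then show ?thesis
      using eq[OF that] by (simp add: lebesgue_integral_eq_integral)
  qed
  have "continuous_on {0..T} (\<lambda>u. integral {0..u} (\<lambda>s. L (D s)))"
    using integrable_on_lebesgue_on[OF int] by (intro indefinite_integral_continuous_1) simp
  then have cont: "continuous_on {0..T} D"
    by (rule continuous_on_eq) (simp add: D_eq)
  have ftc: "((\<lambda>u. integral {0..u} (\<lambda>s. L (D s))) has_vector_derivative L (D u)) (at u within {0..T})"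
    if "u \<in> {0..T}" for u
    by (rule integral_has_vector_derivative[OF bounded_linear.continuous_on[OF L cont] that])
  have D': "(D has_vector_derivative L (D u)) (at u within {0..T})" if "u \<in> {0..T}" for u
    by (rule has_vector_derivative_transform[OF that D_eq ftc[OF that]])
  obtain C where C: "\<And>x. norm (L x) \<le> norm x * C"
    using bounded_linear.bounded[OF L] by blast
  define \<phi> where "\<phi> = (\<lambda>u. exp (- 2 * C * u) * (D u \<bullet> D u))"
  have "\<phi> t \<le> \<phi> 0"
  proof (rule DERIV_nonpos_imp_decreasing_open[where f = \<phi> and a = 0 and b = t])
    show "continuous_on {0..t} \<phi>"
      unfolding \<phi>_def using continuous_on_subset[OF cont, of "{0..t}"] t by (auto intro!: continuous_intros)
    fix u assume u: "0 < u" "u < t"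
    then have "(D has_vector_derivative L (D u)) (at u)"
      using D'[of u] t at_within_Icc_at[of 0 u T] by simp
    then have "(D has_derivative (\<lambda>h. h *\<^sub>R L (D u))) (at u)"
      by (simp add: has_vector_derivative_def)
    from has_derivative_inner[OF this this]
    have "((\<lambda>u. D u \<bullet> D u) has_real_derivative 2 * (D u \<bullet> L (D u))) (at u)"
      unfolding has_field_derivative_def
      by (rule has_derivative_eq_rhs) (simp add: fun_eq_iff inner_commute)
    moreover have "((\<lambda>u. exp (- 2 * C * u)) has_real_derivative - 2 * C * exp (- 2 * C * u)) (at u)"
      by (auto intro!: derivative_eq_intros)
    ultimately have "(\<phi> has_real_derivative - 2 * C * exp (- 2 * C * u) * (D u \<bullet> D u) +
        2 * (D u \<bullet> L (D u)) * exp (- 2 * C * u)) (at u)"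
      unfolding \<phi>_def by (intro DERIV_mult)
    moreover have "D u \<bullet> L (D u) \<le> C * (D u \<bullet> D u)"
    proof -
      have "D u \<bullet> L (D u) \<le> norm (D u) * norm (L (D u))" by (rule norm_cauchy_schwarz)
      also have "\<dots> \<le> norm (D u) * (norm (D u) * C)" by (intro mult_left_mono C) simp
      finally show ?thesis by (simp add: dot_square_norm power2_eq_square mult_ac)
    qed
    then have "exp (- 2 * C * u) * (D u \<bullet> L (D u)) \<le> exp (- 2 * C * u) * (C * (D u \<bullet> D u))"
      by (intro mult_left_mono) simp_all
    then have "- 2 * C * exp (- 2 * C * u) * (D u \<bullet> D u) + 2 * (D u \<bullet> L (D u)) * exp (- 2 * C * u) \<le> 0"
      by (simp add: mult_ac)
    ultimately show "\<exists>y. (\<phi> has_real_derivative y) (at u) \<and> y \<le> 0" by blast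
  qed (use t in simp)
  moreover have "D 0 = 0" using D_eq[of 0] t by simp
  ultimately have "exp (- 2 * C * t) * (D t \<bullet> D t) \<le> 0" by (simp add: \<phi>_def)
  then have "D t \<bullet> D t \<le> 0"
    by (simp add: mult_le_0_iff)
  then show ?thesis using inner_gt_zero_iff[of "D t"] by (metis not_less)
qed

text \<open>The difference of two solutions for the same input solves the homogeneous equation. So the
  solution picked by the choice operator is the explicit one, and it is affine in the input.\<close>

lemma gramian_eq_response:
  assumes v: "bounded_input T v" and t: "t \<in> {0..T}"
  shows "gramian A B T v t = response A B v t"
proof -
  interpret L: bounded_linear "lyap_op A" by (rule bounded_linear_lyap_op)
  define G where "G = gramian A B T v"
  define R where "R = response A B v"
  have R: "lyap_solution A B T v R"
    unfolding R_def by (rule lyap_solution_response[OF v])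
  then have G: "lyap_solution A B T v G"
    unfolding G_def gramian_def by (rule someI[of "lyap_solution A B T v"])
  have diff: "lyap_rhs A B (v s) (G s) - lyap_rhs A B (v s) (R s) = lyap_op A (G s - R s)" for s
    by (simp add: lyap_rhs_eq L.diff)
  have int: "integrable (lebesgue_on {0..u}) (\<lambda>s. lyap_rhs A B (v s) (G s))"
    "integrable (lebesgue_on {0..u}) (\<lambda>s. lyap_rhs A B (v s) (R s))" if "u \<in> {0..T}" for u
    using G R that unfolding lyap_solution_def
    by (auto intro: Equivalence_Lebesgue_Henstock_Integration.integrable_subinterval)
  have "G t - R t = 0"
  proof (rule linear_ode_zero[OF bounded_linear_lyap_op _ _ t])
    show "integrable (lebesgue_on {0..T}) (\<lambda>s. lyap_op A (G s - R s))"
      using t unfolding diff[symmetric] by (intro Bochner_Integration.integrable_diff int) auto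
    fix u assume u: "u \<in> {0..T}"
    have "G u - R u = (LINT s|lebesgue_on {0..u}. lyap_rhs A B (v s) (G s))
        - (LINT s|lebesgue_on {0..u}. lyap_rhs A B (v s) (R s))"
      using G R u by (simp add: lyap_solution_def)
    also have "\<dots> = (LINT s|lebesgue_on {0..u}. lyap_op A (G s - R s))"
      unfolding diff[symmetric] by (rule Bochner_Integration.integral_diff[OF int[OF u], symmetric])
    finally show "G u - R u = (LINT s|lebesgue_on {0..u}. lyap_op A (G s - R s))" .
  qed
  then show ?thesis by (simp add: G_def R_def)
qed

section \<open>Dependence of the objective on the input\<close>

text \<open>The gradient is defined through partial derivatives only. Total differentiability turns it
  into a representation of every directional derivative.\<close>

lemma has_real_derivative_along_line:
  fixes K :: "real ^ 'n ^ 'n \<Rightarrow> real"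
  assumes "K differentiable (at G)"
  shows "((\<lambda>s. K (G + s *\<^sub>R H)) has_real_derivative mat_grad K G \<bullet> H) (at 0)"
proof -
  obtain D where D: "(K has_derivative D) (at G)"
    using assms by (auto simp: differentiable_def)
  interpret D: bounded_linear D by (rule has_derivative_bounded_linear[OF D])
  have line: "((\<lambda>s. K (G + s *\<^sub>R X)) has_real_derivative D X) (at 0)" for X
  proof -
    have "((\<lambda>s. G + s *\<^sub>R X) has_derivative (\<lambda>h. h *\<^sub>R X)) (at 0)"
      by (auto intro!: derivative_eq_intros)
    from has_derivative_compose[OF this, of K D] D
    have "((\<lambda>s. K (G + s *\<^sub>R X)) has_derivative (\<lambda>h. D (h *\<^sub>R X))) (at 0)"
      by simp
    then show ?thesis
      unfolding has_field_derivative_def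
      by (rule has_derivative_eq_rhs) (simp add: fun_eq_iff D.scaleR)
  qed
  have grad: "mat_grad K G $ i $ j = D (axis i (axis j 1))" for i j
    using DERIV_imp_deriv[OF line] by (simp add: mat_grad_def)
  have "H = (\<Sum>i\<in>UNIV. \<Sum>j\<in>UNIV. H $ i $ j *\<^sub>R axis i (axis j 1))"
    by (simp add: vec_eq_iff sum_component axis_def if_distrib[of "\<lambda>x. x $ _"]
        if_distrib[of "\<lambda>x. _ * x"] sum.If_cases cong: if_cong)
  then have "D H = D (\<Sum>i\<in>UNIV. \<Sum>j\<in>UNIV. H $ i $ j *\<^sub>R axis i (axis j 1))"
    by simp
  also have "\<dots> = mat_grad K G \<bullet> H"
    by (simp add: D.sum D.scaleR grad inner_vec_def mult.commute)
  finally show ?thesis using line[of H] by simp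
qed

lemma entire_real_switching: "entire_real (\<lambda>t. switching A B T K v j t)"
  unfolding switching_eq_inner by (rule entire_real_reflect[OF entire_real_inner_impulse_gramian])

lemma bounded_input_add_scaleR:
  assumes v: "bounded_input T v" and d: "bounded_input T d"
  shows "bounded_input T (\<lambda>t. v t + s *\<^sub>R d t)"
proof -
  obtain C where C: "\<And>t j. t \<in> {0..T} \<Longrightarrow> \<bar>v t $ j\<bar> \<le> C"
    by (rule bounded_inputD[OF v]) blast
  obtain D where D: "\<And>t j. t \<in> {0..T} \<Longrightarrow> \<bar>d t $ j\<bar> \<le> D"
    by (rule bounded_inputD[OF d]) blast
  have "\<bar>(v t + s *\<^sub>R d t) $ j\<bar> \<le> C + \<bar>s\<bar> * D" if "t \<in> {0..T}" for t j
    unfolding vector_add_component vector_scaleR_component real_scaleR_def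
    using C[OF that, of j] mult_left_mono[OF D[OF that, of j], of "\<bar>s\<bar>"]
    by (intro order_trans[OF abs_triangle_ineq]) (simp add: abs_mult)
  moreover have "(\<lambda>t. v t + s *\<^sub>R d t) \<in> borel_measurable (lebesgue_on {0..T})"
    using v d by (auto simp: bounded_input_def intro!: borel_measurable_add borel_measurable_scaleR)
  ultimately show ?thesis by (intro bounded_inputI)
qed

lemma response_add_scaleR:
  assumes v: "bounded_input t v" and d: "bounded_input t d"
  shows "response A B (\<lambda>t. v t + s *\<^sub>R d t) t = response A B v t + s *\<^sub>R response A B d t"
proof -
  have "response A B (\<lambda>t. v t + s *\<^sub>R d t) t =
      (\<Sum>j\<in>UNIV. (LINT r|lebesgue_on {0..t}. v r $ j *\<^sub>R impulse_gramian A (column j B) (t - r))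
        + s *\<^sub>R (LINT r|lebesgue_on {0..t}. d r $ j *\<^sub>R impulse_gramian A (column j B) (t - r)))"
    unfolding response_def
  proof (rule sum.cong[OF refl])
    fix j
    let ?P = "\<lambda>r. impulse_gramian A (column j B) (t - r)"
    have "(LINT r|lebesgue_on {0..t}. (v r + s *\<^sub>R d r) $ j *\<^sub>R ?P r) =
        (LINT r|lebesgue_on {0..t}. v r $ j *\<^sub>R ?P r + s *\<^sub>R (d r $ j *\<^sub>R ?P r))"
      by (simp add: scaleR_add_left)
    also have "\<dots> = (LINT r|lebesgue_on {0..t}. v r $ j *\<^sub>R ?P r)
        + (LINT r|lebesgue_on {0..t}. s *\<^sub>R (d r $ j *\<^sub>R ?P r))"
      by (intro Bochner_Integration.integral_add integrable_scaleR_right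
          integrable_response_kernel[OF v continuous_on_impulse_gramian]
          integrable_response_kernel[OF d continuous_on_impulse_gramian])
    finally show "(LINT r|lebesgue_on {0..t}. (v r + s *\<^sub>R d r) $ j *\<^sub>R ?P r) =
        (LINT r|lebesgue_on {0..t}. v r $ j *\<^sub>R ?P r) + s *\<^sub>R (LINT r|lebesgue_on {0..t}. d r $ j *\<^sub>R ?P r)"
      by (simp only: integral_scaleR_right)
  qed
  then show ?thesis by (simp only: response_def sum.distrib scaleR_sum_right)
qed

lemma response_cong_AE:
  assumes v: "bounded_input t v" and w: "bounded_input t w"
    and eq: "AE r in lebesgue_on {0..t}. v r = w r"
  shows "response A B v t = response A B w t"
  unfolding response_def
proof (rule sum.cong[OF refl])
  fix j
  show "(LINT r|lebesgue_on {0..t}. v r $ j *\<^sub>R impulse_gramian A (column j B) (t - r)) =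
      (LINT r|lebesgue_on {0..t}. w r $ j *\<^sub>R impulse_gramian A (column j B) (t - r))"
    by (intro integral_cong_AE borel_measurable_integrable
          integrable_response_kernel[OF v continuous_on_impulse_gramian]
          integrable_response_kernel[OF w continuous_on_impulse_gramian])
       (use eq in eventually_elim, simp)
qed

section \<open>The polytope of admissible control values\<close>

text \<open>The admissible control values at a single time. On nonnegative vectors the \<open>l\<^sup>1\<close> norm is the
  sum of the entries, which makes convexity visible.\<close>

definition control_polytope :: "real \<Rightarrow> (real ^ 'p) set" where
  "control_polytope \<beta> = {w. (\<forall>j. 0 \<le> w $ j \<and> w $ j \<le> 1) \<and> (\<Sum>j\<in>UNIV. w $ j) \<le> \<beta>}"

lemma control_polytope_iff:
  "w \<in> control_polytope \<beta> \<longleftrightarrow> (\<forall>j. w $ j \<in> {0..1}) \<and> l1_norm w \<le> \<beta>"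
  by (auto simp: control_polytope_def l1_norm_def)

lemma convex_control_polytope: "convex (control_polytope \<beta>)"
proof (rule convexI)
  fix x y :: "real ^ 'a" and a b :: real
  assume xy: "x \<in> control_polytope \<beta>" "y \<in> control_polytope \<beta>" and ab: "0 \<le> a" "0 \<le> b" "a + b = 1"
  have "a * (\<Sum>j\<in>UNIV. x $ j) + b * (\<Sum>j\<in>UNIV. y $ j) \<le> \<beta>"
    using xy ab by (intro convex_bound_le) (auto simp: control_polytope_def)
  moreover have "a * x $ j + b * y $ j \<le> 1" for j
    using xy ab by (intro convex_bound_le) (auto simp: control_polytope_def)
  ultimately show "a *\<^sub>R x + b *\<^sub>R y \<in> control_polytope \<beta>"
    using xy ab by (auto simp: control_polytope_def sum.distrib sum_distrib_left)
qed

lemma closed_control_polytope: "closed (control_polytope \<beta>)"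
  unfolding control_polytope_def
  by (intro closed_Collect_conj closed_Collect_all closed_Collect_le continuous_intros)

text \<open>Feasibility of two opposite steps suffices for all shorter ones; this keeps the sets of times
  considered below measurable, as they are cut out by two conditions instead of a continuum.\<close>

lemma control_polytope_segment:
  assumes "w + \<delta> *\<^sub>R u \<in> control_polytope \<beta>" "w - \<delta> *\<^sub>R u \<in> control_polytope \<beta>" "\<delta> > 0" "\<bar>c\<bar> \<le> \<delta>"
  shows "w + c *\<^sub>R u \<in> control_polytope \<beta>"
proof -
  define a b where "a = (\<delta> + c) / (2 * \<delta>)" and "b = (\<delta> - c) / (2 * \<delta>)"
  have ab: "0 \<le> a" "0 \<le> b" "a + b = 1" "(a - b) * \<delta> = c"
    using assms(3,4) by (auto simp: a_def b_def field_simps)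
  have "a *\<^sub>R (w + \<delta> *\<^sub>R u) + b *\<^sub>R (w - \<delta> *\<^sub>R u) = (a + b) *\<^sub>R w + ((a - b) * \<delta>) *\<^sub>R u"
    by (simp add: algebra_simps)
  also have "\<dots> = w + c *\<^sub>R u" using ab by simp
  finally show ?thesis
    using convexD[OF convex_control_polytope assms(1,2) ab(1-3)] by simp
qed

text \<open>Raising one entry, or exchanging mass between two entries. The objective changes at the rates
  \<open>q\<^sub>j\<close> and \<open>q\<^sub>i - q\<^sub>j\<close> along them, which are the functions assumed not to be constant.\<close>

definition edge_directions :: "(real ^ 'p) set" where
  "edge_directions = range (\<lambda>j. axis j 1) \<union> {axis i 1 - axis j 1 | i j. i \<noteq> j}"

lemma finite_edge_directions: "finite (edge_directions :: (real ^ 'p) set)"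
proof (rule finite_subset)
  show "edge_directions \<subseteq> range (\<lambda>j. axis j 1) \<union> (\<lambda>(i, j). axis i 1 - axis j 1) ` UNIV"
    by (auto simp: edge_directions_def)
qed simp

text \<open>The combinatorial heart: a value with a fractional entry is interior to a segment of admissible
  values. Two fractional entries can be traded against each other at constant sum. If exactly one
  entry is fractional, the sum is a natural number \<open>m\<close> plus a proper fraction; when \<open>\<beta>\<close> is a natural
  number this forces \<open>m + 1 \<le> \<beta>\<close>, and when \<open>\<beta>\<close> is at least the number of entries it holds
  anyway, so the fractional entry can move in both directions. For other positive \<open>\<beta>\<close> the
  polytope has fractional vertices.\<close>

lemma non_binary_direction:
  fixes w :: "real ^ 'p"
  assumes w: "w \<in> control_polytope \<beta>" and \<beta>: "\<beta> \<in> \<nat> \<or> real CARD('p) \<le> \<beta>"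
    and j: "w $ j \<notin> {0, 1}"
  obtains u \<delta> where "u \<in> edge_directions" "\<delta> > 0"
    "w + \<delta> *\<^sub>R u \<in> control_polytope \<beta>" "w - \<delta> *\<^sub>R u \<in> control_polytope \<beta>"
proof -
  have bounds: "0 \<le> w $ k" "w $ k \<le> 1" for k
    using w by (auto simp: control_polytope_def)
  have sum_w: "(\<Sum>k\<in>UNIV. w $ k) \<le> \<beta>"
    using w by (simp add: control_polytope_def)
  have sum_axis: "(\<Sum>k\<in>UNIV. axis i (1::real) $ k) = 1" for i :: 'p
    by (simp add: axis_def)
  have frac_j: "0 < w $ j" "w $ j < 1"
    using j bounds[of j] by auto
  show ?thesis
  proof (cases "\<exists>i. i \<noteq> j \<and> w $ i \<notin> {0, 1}")
    case True
    then obtain i where i: "i \<noteq> j" "w $ i \<notin> {0, 1}" by blast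
    have frac_i: "0 < w $ i" "w $ i < 1"
      using i bounds[of i] by auto
    define \<delta> where "\<delta> = Min {w $ i, 1 - w $ i, w $ j, 1 - w $ j}"
    define u :: "real ^ 'p" where "u = axis i 1 - axis j 1"
    have \<delta>: "\<delta> > 0" "\<delta> \<le> w $ i" "\<delta> \<le> 1 - w $ i" "\<delta> \<le> w $ j" "\<delta> \<le> 1 - w $ j"
      using frac_i frac_j by (auto simp: \<delta>_def)
    have "w + c *\<^sub>R u \<in> control_polytope \<beta>" if "\<bar>c\<bar> \<le> \<delta>" for c
    proof -
      have "0 \<le> (w + c *\<^sub>R u) $ k \<and> (w + c *\<^sub>R u) $ k \<le> 1" for k
        using that \<delta> i(1) bounds[of k] by (auto simp: u_def axis_def)
      moreover have "(\<Sum>k\<in>UNIV. (w + c *\<^sub>R u) $ k) = (\<Sum>k\<in>UNIV. w $ k)"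
        by (simp add: u_def sum.distrib sum_subtractf sum_axis sum_distrib_left[symmetric])
      ultimately show ?thesis using sum_w by (simp add: control_polytope_def)
    qed
    from this[of \<delta>] this[of "- \<delta>"] show ?thesis
      using \<delta>(1) i(1) by (intro that[of u \<delta>]) (auto simp: u_def edge_directions_def)
  next
    case False
    then have binary: "w $ i \<in> {0, 1}" if "i \<noteq> j" for i using that by blast
    define m where "m = card {i. i \<noteq> j \<and> w $ i = 1}"
    have "(\<Sum>k\<in>UNIV. w $ k) = w $ j + (\<Sum>k\<in>UNIV - {j}. w $ k)"
      by (rule sum.remove) auto
    also have "(\<Sum>k\<in>UNIV - {j}. w $ k) = (\<Sum>k\<in>UNIV - {j}. (if w $ k = 1 then 1 else 0))"
      using binary by (intro sum.cong) auto
    also have "\<dots> = real m"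
    proof -
      have "{i. i \<noteq> j \<and> w $ i = 1} = (UNIV - {j}) \<inter> {k. w $ k = 1}" by auto
      then show ?thesis by (simp add: sum.If_cases m_def)
    qed
    finally have sum_eq: "(\<Sum>k\<in>UNIV. w $ k) = w $ j + real m" .
    have room: "real m + 1 \<le> \<beta>"
      using \<beta>
    proof
      assume "\<beta> \<in> \<nat>"
      then obtain b where b: "\<beta> = real b" by (auto simp: Nats_def)
      have "real m < real b" using sum_w sum_eq frac_j by (simp add: b)
      then show ?thesis by (simp add: b)
    next
      assume "real CARD('p) \<le> \<beta>"
      moreover have "m < CARD('p)"
        unfolding m_def by (intro psubset_card_mono) auto
      ultimately show ?thesis by linarith
    qed
    define \<delta> where "\<delta> = min (w $ j) (1 - w $ j)"
    have \<delta>: "\<delta> > 0" "\<delta> \<le> w $ j" "\<delta> \<le> 1 - w $ j"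
      using frac_j by (auto simp: \<delta>_def)
    have "w + c *\<^sub>R axis j 1 \<in> control_polytope \<beta>" if "\<bar>c\<bar> \<le> \<delta>" for c
    proof -
      have "0 \<le> (w + c *\<^sub>R axis j 1) $ k \<and> (w + c *\<^sub>R axis j 1) $ k \<le> 1" for k
        using that \<delta> bounds[of k] by (auto simp: axis_def)
      moreover have "(\<Sum>k\<in>UNIV. (w + c *\<^sub>R axis j 1) $ k) = w $ j + real m + c"
        by (simp add: sum.distrib sum_axis sum_distrib_left[symmetric] sum_eq)
      ultimately show ?thesis using room that \<delta> by (simp add: control_polytope_def)
    qed
    from this[of \<delta>] this[of "- \<delta>"] show ?thesis
      using \<delta>(1) by (intro that[of "axis j 1" \<delta>]) (auto simp: edge_directions_def)
  qed
qed

section \<open>First-order optimality\<close>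

lemma feasible1_iff:
  "v \<in> feasible1 T \<alpha> \<beta> \<longleftrightarrow> v \<in> borel_measurable (lebesgue_on {0..T}) \<and>
     (\<forall>t\<in>{0..T}. v t \<in> control_polytope \<beta>) \<and> (\<forall>j. L1_norm T (\<lambda>t. v t $ j) \<le> \<alpha> $ j)"
  by (auto simp: feasible1_def control_polytope_iff)

lemma feasible1_bounded_input: "v \<in> feasible1 T \<alpha> \<beta> \<Longrightarrow> bounded_input T v"
  by (auto simp: feasible1_def bounded_input_def intro!: exI[of _ 1])

lemma maximizers_iff: "v \<in> maximizers J V \<longleftrightarrow> v \<in> V \<and> (\<forall>w\<in>V. J w \<le> J v)"
  by (auto simp: maximizers_def is_arg_max_def not_less)

lemma local_optimal_if_maximizer:
  "v \<in> maximizers (objective A B T K) (feasible1 T \<alpha> \<beta>) \<Longrightarrow> local_optimal A B T K \<alpha> \<beta> v"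
  by (auto simp: local_optimal_def maximizers_iff intro: exI[of _ 1])

text \<open>If both \<open>v + d\<close> and \<open>v - d\<close>, and everything between, compete with the maximizer \<open>v\<close>, then the
  objective restricted to this line has an interior maximum, so its derivative vanishes. As the
  Gramian is affine in the input, that derivative is the integral of \<open>d\<close> against the switching
  functions.\<close>

lemma first_order_condition:
  fixes d :: "real \<Rightarrow> real ^ 'p"
  assumes T: "0 \<le> T" and K: "\<And>G. K differentiable (at G)"
    and v: "v \<in> maximizers (objective A B T K) (feasible1 T \<alpha> \<beta>)"
    and d: "bounded_input T d"
    and feasible: "\<And>s. \<bar>s\<bar> \<le> 1 \<Longrightarrow> (\<lambda>t. v t + s *\<^sub>R d t) \<in> feasible1 T \<alpha> \<beta>"
  shows "(LINT t|lebesgue_on {0..T}. (\<Sum>j\<in>UNIV. d t $ j * switching A B T K v j t)) = 0"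
proof -
  have bv: "bounded_input T v"
    using v by (auto simp: maximizers_iff intro: feasible1_bounded_input)
  have TT: "T \<in> {0..T}" using T by simp
  define G where "G = gramian A B T v T"
  define H where "H = response A B d T"
  have obj: "objective A B T K (\<lambda>t. v t + s *\<^sub>R d t) = K (G + s *\<^sub>R H)" for s
    by (simp add: objective_def G_def H_def gramian_eq_response[OF _ TT] bv d
        bounded_input_add_scaleR response_add_scaleR)
  have "((\<lambda>s. K (G + s *\<^sub>R H)) has_real_derivative mat_grad K G \<bullet> H) (at 0)"
    by (rule has_real_derivative_along_line[OF K])
  moreover have "\<forall>s. \<bar>0 - s\<bar> < 1 \<longrightarrow> K (G + s *\<^sub>R H) \<le> K (G + 0 *\<^sub>R H)"
  proof (intro allI impI)
    fix s :: real assume "\<bar>0 - s\<bar> < 1"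
    then have "objective A B T K (\<lambda>t. v t + s *\<^sub>R d t) \<le> objective A B T K v"
      using v feasible[of s] by (auto simp: maximizers_iff)
    then show "K (G + s *\<^sub>R H) \<le> K (G + 0 *\<^sub>R H)"
      by (simp add: obj) (simp add: objective_def G_def)
  qed
  ultimately have "mat_grad K G \<bullet> H = 0"
    by (rule DERIV_local_max[OF _ zero_less_one])
  moreover have "mat_grad K G \<bullet> H = (\<Sum>j\<in>UNIV. (LINT t|lebesgue_on {0..T}. d t $ j * switching A B T K v j t))"
    unfolding H_def response_def inner_sum_right
  proof (rule sum.cong[OF refl])
    fix j
    have "mat_grad K G \<bullet> (LINT r|lebesgue_on {0..T}. d r $ j *\<^sub>R impulse_gramian A (column j B) (T - r))
        = (LINT r|lebesgue_on {0..T}. mat_grad K G \<bullet> (d r $ j *\<^sub>R impulse_gramian A (column j B) (T - r)))"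
      by (intro integral_inner_right[symmetric] integrable_response_kernel[OF d continuous_on_impulse_gramian])
    then show "mat_grad K G \<bullet> (LINT r|lebesgue_on {0..T}. d r $ j *\<^sub>R impulse_gramian A (column j B) (T - r))
        = (LINT t|lebesgue_on {0..T}. d t $ j * switching A B T K v j t)"
      by (simp add: switching_eq_inner G_def)
  qed
  moreover have "integrable (lebesgue_on {0..T}) (\<lambda>t. d t $ j * switching A B T K v j t)" for j
  proof -
    obtain C where C: "\<And>t j. t \<in> {0..T} \<Longrightarrow> \<bar>d t $ j\<bar> \<le> C"
      "\<And>j. (\<lambda>t. d t $ j) \<in> borel_measurable (lebesgue_on {0..T})"
      by (rule bounded_inputD[OF d]) blast
    show ?thesis
      using integrable_scaleR_continuous[OF C(2) C(1) continuous_on_entire_real[OF entire_real_switching]]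
      by simp
  qed
  ultimately show ?thesis by (simp add: Bochner_Integration.integral_sum)
qed

text \<open>On a set \<open>F\<close> of positive measure let the value of \<open>v\<close> have room \<open>\<delta>\<close> in both directions \<open>\<plusminus>u\<close>.
  Then \<open>v + h u\<close> is feasible for every \<open>h\<close> that is supported on \<open>F\<close>, bounded by \<open>\<delta>\<close>, and has mean
  zero: the pointwise constraints hold by assumption, and mean zero preserves the budgets
  \<open>\<parallel>v\<^sub>j\<parallel> \<le> \<alpha>\<^sub>j\<close> exactly, whether they are active or not. So \<open>g = \<Sum>\<^sub>j u\<^sub>j q\<^sub>j\<close> is orthogonal to all such \<open>h\<close>.
  Choosing \<open>h\<close> proportional to \<open>g\<close> minus its mean over \<open>F\<close> shows that \<open>g\<close> is almost everywhere
  constant on \<open>F\<close>, and analyticity spreads this to the whole interval.\<close>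

lemma switching_combination_constant:
  fixes v :: "real \<Rightarrow> real ^ 'p"
  assumes T: "0 \<le> T" and K: "\<And>G. K differentiable (at G)"
    and v: "v \<in> maximizers (objective A B T K) (feasible1 T \<alpha> \<beta>)"
    and F: "F \<in> sets lebesgue" "F \<subseteq> {0..T}" "measure lebesgue F \<noteq> 0"
    and \<delta>: "\<delta> > 0" "\<And>t c. t \<in> F \<Longrightarrow> \<bar>c\<bar> \<le> \<delta> \<Longrightarrow> v t + c *\<^sub>R u \<in> control_polytope \<beta>"
  shows "(\<lambda>t. \<Sum>j\<in>UNIV. u $ j * switching A B T K v j t) constant_on {0..T}"
proof -
  let ?M = "lebesgue_on {0..T}"
  define g where "g = (\<lambda>t. \<Sum>j\<in>UNIV. u $ j * switching A B T K v j t)"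
  have g_entire: "entire_real g"
    unfolding g_def by (intro entire_real_sum entire_real_mult entire_real_const entire_real_switching)
  then have g_cont: "continuous_on {0..T} g" by (rule continuous_on_entire_real)
  have v_feas: "v \<in> feasible1 T \<alpha> \<beta>" using v by (simp add: maximizers_iff)
  have v_meas: "v \<in> borel_measurable ?M" using v_feas by (simp add: feasible1_def)
  define \<mu> where "\<mu> = measure lebesgue F"
  have F_M: "F \<in> sets ?M" using F by (simp add: sets_restrict_space_iff)
  have meas_F: "measure ?M F = \<mu>"
    using F(2) by (simp add: \<mu>_def measure_restrict_space)
  \<comment> \<open>the mean of \<open>g\<close> over \<open>F\<close>\<close>
  define m where "m = (LINT t|?M. indicator F t * g t) / \<mu>"
  \<comment> \<open>\<open>D\<close> is chosen positive so that dividing by it is safe even when \<open>g = m\<close> throughout\<close>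
  obtain D where D: "D > 0" "\<And>t. t \<in> {0..T} \<Longrightarrow> \<bar>g t - m\<bar> \<le> D"
  proof -
    have "continuous_on {0..T} (\<lambda>t. g t - m)" using g_cont by (intro continuous_intros)
    then have "bounded ((\<lambda>t. g t - m) ` {0..T})"
      by (rule compact_imp_bounded[OF compact_continuous_image[OF _ compact_Icc]])
    then show ?thesis using that by (fastforce simp: bounded_pos)
  qed
  \<comment> \<open>the factor \<open>\<delta> / D\<close> keeps the perturbation within the available room\<close>
  define h where "h = (\<lambda>t. \<delta> / D * (indicator F t * (g t - m)))"
  have F_ind: "indicator F \<in> borel_measurable ?M" "\<And>t. \<bar>indicator F t :: real\<bar> \<le> 1"
    using F_M by (auto simp: indicator_def)
  have int_F: "integrable ?M (\<lambda>t. indicator F t * f t)" if "continuous_on {0..T} f" for f :: "real \<Rightarrow> real"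
    using integrable_scaleR_continuous[OF F_ind that] by simp
  have h_int: "integrable ?M h"
    unfolding h_def using g_cont by (intro integrable_mult_right int_F continuous_intros)
  have h_mean: "(LINT t|?M. h t) = 0"
  proof -
    have "(LINT t|?M. indicator F t * (g t - m)) = (LINT t|?M. indicator F t * g t - indicator F t * m)"
      by (simp add: right_diff_distrib)
    also have "\<dots> = (LINT t|?M. indicator F t * g t) - (LINT t|?M. indicator F t * m)"
      by (intro Bochner_Integration.integral_diff int_F g_cont continuous_intros)
    also have "(LINT t|?M. indicator F t * m) = \<mu> * m"
      using F(2) by (simp add: meas_F Int_absorb2)
    finally show ?thesis using F(3) by (simp add: h_def m_def \<mu>_def)
  qed
  have h_bound: "\<bar>h t\<bar> \<le> \<delta>" if "t \<in> {0..T}" for t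
  proof -
    have "\<bar>h t\<bar> \<le> \<delta> / D * \<bar>g t - m\<bar>"
      using \<delta>(1) D(1) by (auto simp: h_def indicator_def abs_mult)
    also have "\<dots> \<le> \<delta> / D * D"
      using D that \<delta>(1) by (intro mult_left_mono) auto
    finally show ?thesis using D(1) by simp
  qed
  have h_out: "h t = 0" if "t \<notin> F" for t using that by (simp add: h_def)
  have h_meas: "h \<in> borel_measurable ?M" using h_int by (rule borel_measurable_integrable)
  define d where "d = (\<lambda>t. h t *\<^sub>R u)"
  have d: "bounded_input T d"
  proof -
    have "\<bar>d t $ j\<bar> \<le> \<delta> * norm u" if "t \<in> {0..T}" for t j
      using h_bound[OF that] component_le_norm_cart[of u j]
      by (auto simp: d_def abs_mult intro!: mult_mono)
    moreover have "d \<in> borel_measurable ?M"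
      unfolding d_def using h_meas by (intro borel_measurable_scaleR) simp_all
    ultimately show ?thesis by (intro bounded_inputI)
  qed
  have feasible: "(\<lambda>t. v t + s *\<^sub>R d t) \<in> feasible1 T \<alpha> \<beta>" if s: "\<bar>s\<bar> \<le> 1" for s
    unfolding feasible1_iff
  proof (intro conjI ballI allI)
    show "(\<lambda>t. v t + s *\<^sub>R d t) \<in> borel_measurable ?M"
      using v_meas d by (auto simp: bounded_input_def intro!: borel_measurable_add borel_measurable_scaleR)
    show polytope: "v t + s *\<^sub>R d t \<in> control_polytope \<beta>" if t: "t \<in> {0..T}" for t
    proof (cases "t \<in> F")
      case True
      have "\<bar>s * h t\<bar> \<le> 1 * \<delta>"
        unfolding abs_mult using s h_bound[OF t] by (intro mult_mono) auto
      then show ?thesis using \<delta>(2)[OF True, of "s * h t"] by (simp add: d_def)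
    next
      case False
      then show ?thesis using v_feas t by (simp add: d_def h_out feasible1_iff)
    qed
    fix j
    obtain C where C: "\<And>t j. t \<in> {0..T} \<Longrightarrow> \<bar>v t $ j\<bar> \<le> C"
      "\<And>j. (\<lambda>t. v t $ j) \<in> borel_measurable ?M"
      by (rule bounded_inputD[OF feasible1_bounded_input[OF v_feas]]) blast
    have v_int: "integrable ?M (\<lambda>t. v t $ j)"
      using integrable_scaleR_continuous[OF C(2)[of j] C(1), of "\<lambda>_. 1::real"] by simp
    have "L1_norm T (\<lambda>t. (v t + s *\<^sub>R d t) $ j) = (LINT t|?M. v t $ j + (s * u $ j) * h t)"
      unfolding L1_norm_def
    proof (rule Bochner_Integration.integral_cong[OF refl])
      fix t assume "t \<in> space ?M"
      then have "v t + s *\<^sub>R d t \<in> control_polytope \<beta>" by (intro polytope) simp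
      then have "0 \<le> (v t + s *\<^sub>R d t) $ j" by (simp add: control_polytope_def)
      then show "\<bar>(v t + s *\<^sub>R d t) $ j\<bar> = v t $ j + (s * u $ j) * h t"
        by (simp add: d_def mult_ac)
    qed
    also have "\<dots> = (LINT t|?M. v t $ j) + (LINT t|?M. (s * u $ j) * h t)"
      by (intro Bochner_Integration.integral_add integrable_mult_right v_int h_int)
    also have "(LINT t|?M. (s * u $ j) * h t) = 0"
      by (simp only: integral_mult_right_zero h_mean)
    also have "(LINT t|?M. v t $ j) = L1_norm T (\<lambda>t. v t $ j)"
      unfolding L1_norm_def using v_feas
      by (intro Bochner_Integration.integral_cong) (auto simp: feasible1_def)
    finally show "L1_norm T (\<lambda>t. (v t + s *\<^sub>R d t) $ j) \<le> \<alpha> $ j"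
      using v_feas by (simp add: feasible1_def)
  qed
  have "(LINT t|?M. h t * g t) = 0"
    using first_order_condition[OF T K v d feasible]
    by (simp add: d_def g_def sum_distrib_left mult_ac)
  \<comment> \<open>as \<open>h\<close> has mean zero, \<open>g\<close> may be replaced by \<open>g - m\<close>, which leaves a square\<close>
  moreover have "(LINT t|?M. h t * g t) = (LINT t|?M. \<delta> / D * (indicator F t * (g t - m)\<^sup>2) + m * h t)"
    by (intro Bochner_Integration.integral_cong) (simp_all add: h_def power2_eq_square algebra_simps)
  moreover have sq_int: "integrable ?M (\<lambda>t. indicator F t * (g t - m)\<^sup>2)"
    using g_cont by (intro int_F continuous_intros)
  moreover have "(LINT t|?M. \<delta> / D * (indicator F t * (g t - m)\<^sup>2) + m * h t) =
      (LINT t|?M. \<delta> / D * (indicator F t * (g t - m)\<^sup>2)) + (LINT t|?M. m * h t)"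
    by (intro Bochner_Integration.integral_add integrable_mult_right sq_int h_int)
  ultimately have "(LINT t|?M. indicator F t * (g t - m)\<^sup>2) = 0"
    using \<delta>(1) D(1) by (simp add: h_mean)
  then have "AE t in ?M. indicator F t * (g t - m)\<^sup>2 = 0"
    using integral_nonneg_eq_0_iff_AE[OF sq_int] by simp
  then have AE_g: "AE t in lebesgue. t \<in> F \<longrightarrow> g t = m"
    using F(2) by (auto simp: AE_restrict_space_iff indicator_def elim!: eventually_mono split: if_splits)
  have "infinite {t \<in> {0..T}. g t = m}"
  proof
    assume "finite {t \<in> {0..T}. g t = m}"
    then have "{t \<in> {0..T}. g t = m} \<in> null_sets lebesgue"
      by (intro negligible_iff_null_sets[THEN iffD1] negligible_finite)
    then have "AE t in lebesgue. t \<notin> {t \<in> {0..T}. g t = m}" by (rule AE_not_in)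
    with AE_g have "AE t in lebesgue. t \<notin> F"
      by eventually_elim (use F(2) in auto)
    then have "F \<in> null_sets lebesgue"
      using F(1) by (simp add: AE_iff_null_sets)
    then show False using F(3) by (simp add: measure_eq_0_null_sets)
  qed
  then have "g t = m" for t
    by (rule entire_real_constant_if_infinite_level[OF g_entire])
  then show ?thesis unfolding g_def[symmetric] constant_on_def by blast
qed

section \<open>Relaxed maximizers are binary\<close>

text \<open>The times at which the control is not binary are covered by the countably many sets \<open>F u n\<close>
  of times with room \<open>1 / (n + 1)\<close> along an edge direction \<open>u\<close>. A set of positive measure among
  them would make some \<open>q\<^sub>j\<close> or some \<open>q\<^sub>i - q\<^sub>j\<close> constant.\<close>

lemma maximizer_AE_binary:
  fixes v :: "real \<Rightarrow> real ^ 'p"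
  assumes T: "0 \<le> T" and K: "\<And>G. K differentiable (at G)"
    and \<beta>: "\<beta> \<in> \<nat> \<or> real CARD('p) \<le> \<beta>"
    and v: "v \<in> maximizers (objective A B T K) (feasible1 T \<alpha> \<beta>)"
    and q: "\<And>j. \<not> (switching A B T K v j) constant_on {0..T}"
    and qq: "\<And>i j. i \<noteq> j \<Longrightarrow>
       \<not> (\<lambda>t. switching A B T K v i t - switching A B T K v j t) constant_on {0..T}"
  shows "AE t in lebesgue_on {0..T}. \<forall>j. v t $ j \<in> {0, 1}"
proof -
  have v_feas: "v \<in> feasible1 T \<alpha> \<beta>" using v by (simp add: maximizers_iff)
  have v_meas: "v \<in> borel_measurable (lebesgue_on {0..T})" using v_feas by (simp add: feasible1_def)
  define F where "F = (\<lambda>u n. {t \<in> {0..T}. v t + (1 / real (Suc n)) *\<^sub>R u \<in> control_polytope \<beta>}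
    \<inter> {t \<in> {0..T}. v t - (1 / real (Suc n)) *\<^sub>R u \<in> control_polytope \<beta>})"
  have F_sets: "F u n \<in> sets lebesgue" for u n
  proof -
    have "(\<lambda>t. v t + (1 / real (Suc n)) *\<^sub>R u) \<in> borel_measurable (lebesgue_on {0..T})"
      "(\<lambda>t. v t - (1 / real (Suc n)) *\<^sub>R u) \<in> borel_measurable (lebesgue_on {0..T})"
      using v_meas by (auto intro!: borel_measurable_add borel_measurable_diff)
    then have "F u n \<in> sets (lebesgue_on {0..T})"
      unfolding F_def borel_measurable_vimage_closed using closed_control_polytope by blast
    then show ?thesis by (simp add: sets_restrict_space_iff)
  qed
  have F_null: "F u n \<in> null_sets lebesgue" if u: "u \<in> edge_directions" for u n
  proof (rule ccontr)
    assume "F u n \<notin> null_sets lebesgue"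
    moreover have "F u n \<in> lmeasurable"
      using F_sets by (intro bounded_set_imp_lmeasurable bounded_subset[of "{0..T}" "F u n"]) (auto simp: F_def)
    ultimately have pos: "measure lebesgue (F u n) \<noteq> 0"
      by (simp add: negligible_iff_measure negligible_iff_null_sets[symmetric])
    have const: "(\<lambda>t. \<Sum>j\<in>UNIV. u $ j * switching A B T K v j t) constant_on {0..T}"
    proof (rule switching_combination_constant[where F = "F u n" and \<delta> = "1 / real (Suc n)"])
      show "0 < 1 / real (Suc n)" by simp
      show "F u n \<subseteq> {0..T}" by (auto simp: F_def)
      show "v t + c *\<^sub>R u \<in> control_polytope \<beta>" if "t \<in> F u n" "\<bar>c\<bar> \<le> 1 / real (Suc n)" for t c
      proof (rule control_polytope_segment[OF _ _ _ that(2)])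
        show "v t + (1 / real (Suc n)) *\<^sub>R u \<in> control_polytope \<beta>"
          "v t - (1 / real (Suc n)) *\<^sub>R u \<in> control_polytope \<beta>"
          using that(1) unfolding F_def by blast+
      qed simp
    qed (fact T K v F_sets pos)+
    have axis_sum: "(\<Sum>k\<in>UNIV. axis i 1 $ k * f k) = f i" for i :: 'p and f :: "'p \<Rightarrow> real"
    proof -
      have "axis i 1 $ k * f k = (if k = i then f k else 0)" for k
        by (simp add: axis_def)
      then show ?thesis by simp
    qed
    from u consider (single) j where "u = axis j 1" | (pair) i j where "i \<noteq> j" "u = axis i 1 - axis j 1"
      by (auto simp: edge_directions_def)
    then show False
    proof cases
      case single
      with const q[of j] show False by (simp add: axis_sum)
    next
      case pair
      with const qq[of i j] show False by (simp add: axis_sum left_diff_distrib sum_subtractf)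
    qed
  qed
  have "(\<Union>u\<in>edge_directions. \<Union>n. F u n) \<in> null_sets lebesgue"
    using finite_edge_directions F_null
    by (intro null_sets_UN' null_sets_UN) (auto intro: countable_finite)
  then have "AE t in lebesgue. t \<notin> (\<Union>u\<in>edge_directions. \<Union>n. F u n)" by (rule AE_not_in)
  then have "AE t in lebesgue. t \<in> {0..T} \<longrightarrow> (\<forall>j. v t $ j \<in> {0, 1})"
  proof eventually_elim
    fix t assume t: "t \<notin> (\<Union>u\<in>edge_directions. \<Union>n. F u n)"
    show "t \<in> {0..T} \<longrightarrow> (\<forall>j. v t $ j \<in> {0, 1})"
    proof (intro impI allI, rule ccontr)
      fix j assume tT: "t \<in> {0..T}" and j: "v t $ j \<notin> {0, 1}"
      have vt: "v t \<in> control_polytope \<beta>" using v_feas tT by (simp add: feasible1_iff)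
      obtain u \<delta> where u: "u \<in> edge_directions" "\<delta> > 0"
        "v t + \<delta> *\<^sub>R u \<in> control_polytope \<beta>" "v t - \<delta> *\<^sub>R u \<in> control_polytope \<beta>"
        by (rule non_binary_direction[OF vt \<beta> j])
      obtain n where n: "1 / real (Suc n) < \<delta>" using nat_approx_posE[OF u(2)] .
      have "v t + c *\<^sub>R u \<in> control_polytope \<beta>" if "\<bar>c\<bar> \<le> \<delta>" for c
        by (rule control_polytope_segment[OF u(3,4,2) that])
      note perturb = this
      have c: "\<bar>1 / real (Suc n)\<bar> \<le> \<delta>" "\<bar>- (1 / real (Suc n))\<bar> \<le> \<delta>"
        using n by simp_all
      have "t \<in> F u n"
        using perturb[OF c(1)] perturb[OF c(2)] tT
        unfolding F_def scaleR_minus_left add_uminus_conv_diff by blast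
      with t u(1) show False by blast
    qed
  qed
  then show ?thesis by (simp add: AE_restrict_space_iff)
qed

lemma L1_norm_binary:
  assumes "\<And>t. t \<in> {0..T} \<Longrightarrow> f t \<in> {0, 1}"
  shows "L1_norm T f = L0_norm T f"
proof -
  have "L1_norm T f = (LINT t|lebesgue_on {0..T}. indicator {t \<in> {0..T}. f t \<noteq> 0} t)"
    unfolding L1_norm_def
  proof (rule Bochner_Integration.integral_cong[OF refl])
    fix t assume "t \<in> space (lebesgue_on {0..T})"
    then have t: "t \<in> {0..T}" by simp
    with assms[OF t] show "\<bar>f t\<bar> = indicator {t \<in> {0..T}. f t \<noteq> 0} t"
      by (auto simp: indicator_def)
  qed
  also have "\<dots> = measure (lebesgue_on {0..T}) {t \<in> {0..T}. f t \<noteq> 0}"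
    by (simp add: Int_absorb2 subset_eq)
  also have "\<dots> = L0_norm T f"
    unfolding L0_norm_def by (intro measure_restrict_space) auto
  finally show ?thesis .
qed

lemma l1_norm_binary:
  assumes "\<And>j. w $ j \<in> {0, 1}"
  shows "l1_norm w = real (l0_norm w)"
proof -
  have "l1_norm w = (\<Sum>j\<in>UNIV. (if w $ j \<noteq> 0 then 1 else 0))"
    unfolding l1_norm_def using assms by (intro sum.cong) (auto, metis abs_one insertE singletonD)
  then show ?thesis by (simp add: l0_norm_def sum.If_cases)
qed

text \<open>On binary functions the \<open>0\<close>-norms and the \<open>1\<close>-norms agree, both over time and over the entries,
  so the main problem is the relaxed one restricted to binary controls.\<close>

lemma feasible0_iff:
  "v \<in> feasible0 T \<alpha> \<beta> \<longleftrightarrow> v \<in> feasible1 T \<alpha> \<beta> \<and> (\<forall>t\<in>{0..T}. \<forall>j. v t $ j \<in> {0, 1})"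
proof (cases "\<forall>t\<in>{0..T}. \<forall>j. v t $ j \<in> {0, 1}")
  case True
  then have "L1_norm T (\<lambda>t. v t $ j) = L0_norm T (\<lambda>t. v t $ j)" for j
    by (intro L1_norm_binary) blast
  moreover have "l1_norm (v t) = real (l0_norm (v t))" if "t \<in> {0..T}" for t
    using True that by (intro l1_norm_binary) blast
  moreover have "v t $ j \<in> {0..1}" if "t \<in> {0..T}" for t j
  proof -
    have "v t $ j \<in> {0, 1}" using True that by blast
    then show ?thesis by auto
  qed
  ultimately show ?thesis using True by (simp add: feasible0_def feasible1_def)
next
  case False
  then show ?thesis by (auto simp: feasible0_def)
qed

lemma objective_cong_AE:
  assumes T: "0 \<le> T" and v: "v \<in> feasible1 T \<alpha> \<beta>" and w: "w \<in> feasible1 T \<alpha> \<beta>"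
    and eq: "AE t in lebesgue_on {0..T}. v t = w t"
  shows "objective A B T K v = objective A B T K w"
  using response_cong_AE[OF feasible1_bounded_input[OF v] feasible1_bounded_input[OF w] eq, of A B] T
  by (simp add: objective_def gramian_eq_response feasible1_bounded_input[OF v] feasible1_bounded_input[OF w])

text \<open>Membership in the feasible sets is demanded at every time. Switching the control off at the
  exceptional times keeps it admissible, since the polytope contains the origin.\<close>

lemma binary_representative:
  fixes v :: "real \<Rightarrow> real ^ 'p"
  assumes v: "v \<in> feasible1 T \<alpha> \<beta>" and \<beta>: "0 \<le> \<beta>"
    and binary: "AE t in lebesgue_on {0..T}. \<forall>j. v t $ j \<in> {0, 1}"
  obtains w where "w \<in> feasible0 T \<alpha> \<beta>" "AE t in lebesgue_on {0..T}. w t = v t"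
proof
  define S :: "(real ^ 'p) set" where "S = {x. \<forall>j. x $ j = 0 \<or> x $ j = 1}"
  define w where "w = (\<lambda>t. if v t \<in> S then v t else 0)"
  have v_meas: "v \<in> borel_measurable (lebesgue_on {0..T})" using v by (simp add: feasible1_def)
  have "closed S"
    unfolding S_def by (intro closed_Collect_all closed_Collect_disj closed_Collect_eq continuous_intros)
  then have "(\<lambda>x. if x \<in> S then x else 0) \<in> borel_measurable borel"
    by (intro measurable_If_set) auto
  then have w_meas: "w \<in> borel_measurable (lebesgue_on {0..T})"
    unfolding w_def by (rule measurable_compose[OF v_meas])
  show w_eq: "AE t in lebesgue_on {0..T}. w t = v t"
    using binary by eventually_elim (auto simp: w_def S_def)
  have "v t \<in> control_polytope \<beta>" if "t \<in> {0..T}" for t using v that by (simp add: feasible1_iff)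
  then have "w t \<in> control_polytope \<beta>" if "t \<in> {0..T}" for t
    using that \<beta> by (auto simp: w_def control_polytope_def)
  moreover have "L1_norm T (\<lambda>t. w t $ j) \<le> \<alpha> $ j" for j
  proof -
    have comp: "(\<lambda>x :: real ^ 'p. \<bar>x $ j\<bar>) \<in> borel_measurable borel"
      by (intro borel_measurable_continuous_onI continuous_intros)
    have "L1_norm T (\<lambda>t. w t $ j) = L1_norm T (\<lambda>t. v t $ j)"
      unfolding L1_norm_def
      by (intro integral_cong_AE measurable_compose[OF v_meas comp] measurable_compose[OF w_meas comp])
         (use w_eq in eventually_elim, simp)
    then show ?thesis using v by (simp add: feasible1_def)
  qed
  moreover have "w t $ j \<in> {0, 1}" for t j by (auto simp: w_def S_def)
  ultimately show "w \<in> feasible0 T \<alpha> \<beta>"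
    using w_meas by (auto simp: feasible0_iff feasible1_iff)
qed

theorem theorem2:
  fixes A :: "real ^ 'n ^ 'n" and B :: "real ^ 'p ^ 'n"
    and T \<beta> :: real and \<alpha> :: "real ^ 'p" and K :: "real ^ 'n ^ 'n \<Rightarrow> real"
  assumes "T > 0" and "\<And>j. \<alpha> $ j > 0" and "\<beta> > 0"
    and "\<beta> \<in> \<nat> \<or> real CARD('p) \<le> \<beta>"
    and "cont_diff K"
    and "\<And>v j. local_optimal A B T K \<alpha> \<beta> v \<Longrightarrow>
           \<not> (switching A B T K v j) constant_on {0..T}"
    and "\<And>v i j. local_optimal A B T K \<alpha> \<beta> v \<Longrightarrow> i \<noteq> j \<Longrightarrow>
           \<not> (\<lambda>t. switching A B T K v i t - switching A B T K v j t) constant_on {0..T}"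
    and "maximizers (objective A B T K) (feasible1 T \<alpha> \<beta>) \<noteq> {}"
  shows "ae_class T ` maximizers (objective A B T K) (feasible0 T \<alpha> \<beta>) =
         ae_class T ` maximizers (objective A B T K) (feasible1 T \<alpha> \<beta>)"
proof -
  let ?J = "objective A B T K"
  have T: "0 \<le> T" using assms(1) by simp
  have K: "K differentiable (at G)" for G using assms(5) by (simp add: cont_diff_def)
  have binary: "\<exists>w \<in> maximizers ?J (feasible0 T \<alpha> \<beta>). ?J w = ?J v \<and> (AE t in lebesgue_on {0..T}. w t = v t)"
    if v: "v \<in> maximizers ?J (feasible1 T \<alpha> \<beta>)" for v
  proof -
    have v_feas: "v \<in> feasible1 T \<alpha> \<beta>" using v by (simp add: maximizers_iff)
    have "AE t in lebesgue_on {0..T}. \<forall>j. v t $ j \<in> {0, 1}"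
      by (rule maximizer_AE_binary[OF T K assms(4) v])
         (use assms(6,7) local_optimal_if_maximizer[OF v] in blast)+
    then obtain w where w: "w \<in> feasible0 T \<alpha> \<beta>" "AE t in lebesgue_on {0..T}. w t = v t"
      by (rule binary_representative[OF v_feas less_imp_le[OF assms(3)]])
    have eq: "?J w = ?J v"
      using w(1) unfolding feasible0_iff by (intro objective_cong_AE[OF T _ v_feas w(2)]) blast
    have "?J x \<le> ?J w" if "x \<in> feasible0 T \<alpha> \<beta>" for x
      using that v unfolding eq feasible0_iff maximizers_iff by blast
    then have "w \<in> maximizers ?J (feasible0 T \<alpha> \<beta>)"
      using w(1) unfolding maximizers_iff by blast
    with eq w(2) show ?thesis by blast
  qed
  show ?thesis
  proof (intro set_eqI iffI)
    fix X assume "X \<in> ae_class T ` maximizers ?J (feasible0 T \<alpha> \<beta>)"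
    then obtain w where w: "w \<in> maximizers ?J (feasible0 T \<alpha> \<beta>)" "X = ae_class T w" by blast
    \<comment> \<open>the value of the main problem attains the relaxed value, so its maximizers are relaxed maximizers\<close>
    obtain v where v: "v \<in> maximizers ?J (feasible1 T \<alpha> \<beta>)" using assms(8) by blast
    from binary[OF v] obtain w' where "w' \<in> maximizers ?J (feasible0 T \<alpha> \<beta>)" "?J w' = ?J v" by blast
    with w(1) have "?J v \<le> ?J w"
      unfolding maximizers_iff by metis
    with w(1) v have "w \<in> maximizers ?J (feasible1 T \<alpha> \<beta>)"
      unfolding maximizers_iff feasible0_iff by (meson order_trans)
    with w(2) show "X \<in> ae_class T ` maximizers ?J (feasible1 T \<alpha> \<beta>)" by blast
  next
    fix X assume "X \<in> ae_class T ` maximizers ?J (feasible1 T \<alpha> \<beta>)"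
    then obtain v where v: "v \<in> maximizers ?J (feasible1 T \<alpha> \<beta>)" "X = ae_class T v" by blast
    from binary[OF v(1)] obtain w where w: "w \<in> maximizers ?J (feasible0 T \<alpha> \<beta>)"
      "AE t in lebesgue_on {0..T}. w t = v t" by blast
    have "(AE t in lebesgue_on {0..T}. x t = v t) \<longleftrightarrow> (AE t in lebesgue_on {0..T}. x t = w t)" for x
    proof
      assume "AE t in lebesgue_on {0..T}. x t = v t"
      with w(2) show "AE t in lebesgue_on {0..T}. x t = w t" by eventually_elim simp
    next
      assume "AE t in lebesgue_on {0..T}. x t = w t"
      with w(2) show "AE t in lebesgue_on {0..T}. x t = v t" by eventually_elim simp
    qed
    then have "X = ae_class T w" by (simp add: v(2) ae_class_def)
    with w(1) show "X \<in> ae_class T ` maximizers ?J (feasible0 T \<alpha> \<beta>)" by blast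
  qed
qed

end
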